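(* Let $G^{c}_{\mathcal{D}}$ be the graph whose vertices are the Turing degrees, with an edge between $\mathbf{a}$ and $\mathbf{b}$ iff $H(\mathbf{a},\mathbf{b})=1/2$. Then $G^{c}_{\mathcal{D}}$ is connected and has diameter at most $4$.
   Context: For $X\subseteq\omega$, $\rho_n(X)=|X\cap[0,n)|/n$, $\overline{\rho}(X)=\limsup_n\rho_n(X)$; coarse similarity classes $[X]$ (where $X\sim Y$ iff $\lim_n\rho_n(X\bigtriangleup Y)=0$) form the metric space $(\mathcal{S},\delta)$ with $\delta([X],[Y])=\overline{\rho}(X\bigtriangleup Y)$. For degrees $\mathbf{d},\mathbf{e}$, $H(\mathbf{d},\mathbf{e})$ is the Hausdorff distance in $(\mathcal{S},\delta)$ between the closures of $\{[X]:X\le_T\mathbf{d}\}$ and $\{[X]:X\le_T\mathbf{e}\}$. *)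

theory Defs
  imports "HOL-Analysis.Analysis" "Graph_Theory.Graph_Theory"
begin

section \<open>Turing reducibility and Turing degrees\<close>

text \<open>
  Codes for the partial recursive functions relative to an oracle (Kleene's schemata).
  Arities are not recorded in the codes; the argument tuple is a list of numbers, and a code
  applied to a tuple of unsuitable length simply has no value.
\<close>

datatype ocode =
    Zero
  | Succ
  | Proj nat
  | Oracle
  | Comp ocode "ocode list"
  | PrimRec ocode ocode
  | Mu ocode

text \<open>\<open>computes A c xs y\<close>: with oracle \<open>A\<close>, code \<open>c\<close> halts on the tuple \<open>xs\<close> with output \<open>y\<close>.\<close>

inductive computes :: "nat set \<Rightarrow> ocode \<Rightarrow> nat list \<Rightarrow> nat \<Rightarrow> bool" for A :: "nat set" where
  zero: "computes A Zero xs 0"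
| succ: "computes A Succ [x] (Suc x)"
| proj: "i < length xs \<Longrightarrow> computes A (Proj i) xs (xs ! i)"
| query: "computes A Oracle [x] (of_bool (x \<in> A))"
| comp: "list_all2 (\<lambda>g y. computes A g xs y) gs ys \<Longrightarrow> computes A f ys z
    \<Longrightarrow> computes A (Comp f gs) xs z"
| primrec_0: "computes A f xs y \<Longrightarrow> computes A (PrimRec f g) (0 # xs) y"
| primrec_Suc: "computes A (PrimRec f g) (n # xs) r \<Longrightarrow> computes A g (n # r # xs) y
    \<Longrightarrow> computes A (PrimRec f g) (Suc n # xs) y"
| mu: "computes A f (n # xs) 0 \<Longrightarrow> (\<And>m. m < n \<Longrightarrow> \<exists>y>0. computes A f (m # xs) y)
    \<Longrightarrow> computes A (Mu f) xs n"

lemma computes_functional: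
  "computes A c xs y \<Longrightarrow> computes A c xs z \<Longrightarrow> z = y"
proof (induction arbitrary: z rule: computes.induct)
  case (zero xs)
  then show ?case by cases
next
  case (succ x)
  then show ?case by cases simp
next
  case (proj i xs)
  from proj.prems show ?case by cases simp
next
  case (query x)
  then show ?case by cases simp
next
  case (comp xs gs ys f z')
  from comp.prems obtain ys' where ys': "list_all2 (\<lambda>g y. computes A g xs y) gs ys'"
    and f: "computes A f ys' z" by cases
  have "ys' = ys"
  proof (rule nth_equalityI)
    show "length ys' = length ys"
      using list_all2_lengthD[OF ys'] list_all2_lengthD[OF comp.IH(1)] by simp
    fix i assume "i < length ys'"
    then have i: "i < length gs" using list_all2_lengthD[OF ys'] by simp
    show "ys' ! i = ys ! i"
      using list_all2_nthD[OF comp.IH(1) i] list_all2_nthD[OF ys' i] by blast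
  qed
  with f comp.IH(2) show ?case by simp
next
  case (primrec_0 f xs y g)
  from primrec_0.prems show ?case by cases (simp_all add: primrec_0.IH)
next
  case (primrec_Suc f g n xs r y)
  from primrec_Suc.prems show ?case
  proof cases
    case (primrec_Suc r')
    with \<open>\<And>z. computes A (PrimRec f g) (n # xs) z \<Longrightarrow> z = r\<close> have "r' = r" by simp
    with primrec_Suc \<open>\<And>z. computes A g (n # r # xs) z \<Longrightarrow> z = y\<close> show ?thesis by simp
  qed
next
  case (mu f n xs)
  note IH = mu.IH
  from mu.prems show ?case
  proof cases
    case z: mu
    show ?thesis
    proof (rule linorder_cases[of z n])
      assume "z < n"
      with IH(2) z(1) show ?thesis by blast
    next
      assume "n < z"
      with z(2) obtain y where "y > 0" "computes A f (n # xs) y" by blast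
      with IH(1)[OF \<open>computes A f (n # xs) y\<close>] show ?thesis by simp
    qed simp
  qed
qed

definition turing_reducible :: "nat set \<Rightarrow> nat set \<Rightarrow> bool" (infix "\<le>\<^sub>T" 50) where
  "X \<le>\<^sub>T A \<longleftrightarrow> (\<exists>c. \<forall>x. computes A c [x] (of_bool (x \<in> X)))"

definition turing_equivalent :: "nat set \<Rightarrow> nat set \<Rightarrow> bool" (infix "\<equiv>\<^sub>T" 50) where
  "X \<equiv>\<^sub>T Y \<longleftrightarrow> X \<le>\<^sub>T Y \<and> Y \<le>\<^sub>T X"

lemma turing_reducible_refl: "A \<le>\<^sub>T A"
  unfolding turing_reducible_def using computes.query by blast

primrec replace_oracle :: "ocode \<Rightarrow> ocode \<Rightarrow> ocode" where
  "replace_oracle h Zero = Zero"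
| "replace_oracle h Succ = Succ"
| "replace_oracle h (Proj i) = Proj i"
| "replace_oracle h Oracle = h"
| "replace_oracle h (Comp f gs) = Comp (replace_oracle h f) (map (replace_oracle h) gs)"
| "replace_oracle h (PrimRec f g) = PrimRec (replace_oracle h f) (replace_oracle h g)"
| "replace_oracle h (Mu f) = Mu (replace_oracle h f)"

lemma computes_replace_oracle:
  assumes h: "\<And>x. computes B h [x] (of_bool (x \<in> A))"
  shows "computes A c xs y \<Longrightarrow> computes B (replace_oracle h c) xs y"
proof (induction rule: computes.induct)
  case (comp xs gs ys f z)
  then have "list_all2 (\<lambda>g y. computes B g xs y) (map (replace_oracle h) gs) ys"
    by (auto simp: list.rel_map elim: list_all2_mono)
  with comp show ?case by (auto intro: computes.comp)
next
  case (mu f n xs)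
  then show ?case by (auto intro!: computes.mu)
next
  case (query x)
  show ?case using h by simp
qed (auto intro: computes.intros)

lemma turing_reducible_trans: "X \<le>\<^sub>T Y \<Longrightarrow> Y \<le>\<^sub>T Z \<Longrightarrow> X \<le>\<^sub>T Z"
  unfolding turing_reducible_def using computes_replace_oracle by meson

quotient_type turing_degree = "nat set" / turing_equivalent
  by (rule equivpI)
     (auto simp: reflp_def symp_def transp_def turing_equivalent_def
        intro: turing_reducible_refl turing_reducible_trans)

lift_definition reducible_to_degree :: "nat set \<Rightarrow> turing_degree \<Rightarrow> bool" is turing_reducible
  by (auto simp: turing_equivalent_def intro: turing_reducible_trans)


section \<open>The space of coarse similarity classes\<close>

text \<open>The value at \<open>n = 0\<close> is \<open>0\<close> and irrelevant for the limits below.\<close>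

definition partial_density :: "nat \<Rightarrow> nat set \<Rightarrow> real" where
  "partial_density n X = card (X \<inter> {0..<n}) / n"

text \<open>
  The limit superior is taken in the extended reals; it always lies in the unit interval.
\<close>

definition upper_density :: "nat set \<Rightarrow> real" where
  "upper_density X = real_of_ereal (limsup (\<lambda>n. ereal (partial_density n X)))"

definition coarsely_similar :: "nat set \<Rightarrow> nat set \<Rightarrow> bool" where
  "coarsely_similar X Y \<longleftrightarrow> (\<lambda>n. partial_density n (sym_diff X Y)) \<longlonglongrightarrow> 0"

lemma partial_density_bounds: "0 \<le> partial_density n X" "partial_density n X \<le> 1"
proof -
  have "card (X \<inter> {0..<n}) \<le> card {0..<n}" by (rule card_mono) auto
  then show "0 \<le> partial_density n X" "partial_density n X \<le> 1"
    by (auto simp: partial_density_def divide_le_eq_1)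
qed

lemma partial_density_mono: "X \<subseteq> Y \<Longrightarrow> partial_density n X \<le> partial_density n Y"
  unfolding partial_density_def
  by (intro divide_right_mono) (auto intro!: card_mono)

lemma partial_density_Un: "partial_density n (X \<union> Y) \<le> partial_density n X + partial_density n Y"
proof -
  have "card ((X \<union> Y) \<inter> {0..<n}) \<le> card (X \<inter> {0..<n}) + card (Y \<inter> {0..<n})"
    by (metis Int_Un_distrib2 card_Un_le)
  then have "real (card ((X \<union> Y) \<inter> {0..<n})) \<le> card (X \<inter> {0..<n}) + card (Y \<inter> {0..<n})"
    by linarith
  then show ?thesis
    unfolding partial_density_def add_divide_distrib[symmetric]
    by (intro divide_right_mono) auto
qed

lemma partial_density_triangle:
  "partial_density n (sym_diff X Z) \<le> partial_density n (sym_diff X Y) + partial_density n (sym_diff Y Z)"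
  by (rule order_trans[OF partial_density_mono partial_density_Un]) auto

lemma ereal_upper_density: "ereal (upper_density X) = limsup (\<lambda>n. ereal (partial_density n X))"
proof -
  have "0 \<le> limsup (\<lambda>n. ereal (partial_density n X))"
    by (rule le_Limsup) (auto simp: partial_density_bounds)
  moreover have "limsup (\<lambda>n. ereal (partial_density n X)) \<le> 1"
    by (rule Limsup_bounded) (auto simp: partial_density_bounds)
  ultimately show ?thesis
    unfolding upper_density_def
    by (cases "limsup (\<lambda>n. ereal (partial_density n X))") auto
qed

lemma upper_density_bounds: "0 \<le> upper_density X" "upper_density X \<le> 1"
proof -
  have "0 \<le> ereal (upper_density X)" unfolding ereal_upper_density
    by (rule le_Limsup) (auto simp: partial_density_bounds)
  moreover have "ereal (upper_density X) \<le> 1" unfolding ereal_upper_density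
    by (rule Limsup_bounded) (auto simp: partial_density_bounds)
  ultimately show "0 \<le> upper_density X" "upper_density X \<le> 1" by auto
qed

lemma upper_density_triangle:
  "upper_density (sym_diff X Z) \<le> upper_density (sym_diff X Y) + upper_density (sym_diff Y Z)"
proof -
  have "ereal (upper_density (sym_diff X Z))
      \<le> limsup (\<lambda>n. ereal (partial_density n (sym_diff X Y)) + ereal (partial_density n (sym_diff Y Z)))"
    unfolding ereal_upper_density
    by (rule Limsup_mono) (use partial_density_triangle in auto)
  also have "\<dots> \<le> ereal (upper_density (sym_diff X Y)) + ereal (upper_density (sym_diff Y Z))"
    unfolding ereal_upper_density by (rule ereal_limsup_add_mono)
  finally show ?thesis by simp
qed

lemma coarsely_similar_iff: "coarsely_similar X Y \<longleftrightarrow> upper_density (sym_diff X Y) = 0"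
proof
  let ?f = "\<lambda>n. ereal (partial_density n (sym_diff X Y))"
  assume "coarsely_similar X Y"
  then have "?f \<longlonglongrightarrow> ereal 0" by (simp add: coarsely_similar_def)
  then have "limsup ?f = ereal 0" by (simp add: lim_imp_Limsup)
  then show "upper_density (sym_diff X Y) = 0" by (simp add: upper_density_def)
next
  let ?f = "\<lambda>n. ereal (partial_density n (sym_diff X Y))"
  assume "upper_density (sym_diff X Y) = 0"
  then have up: "limsup ?f = 0" using ereal_upper_density[of "sym_diff X Y"] by (simp add: zero_ereal_def)
  have "0 \<le> liminf ?f"
    by (rule Liminf_bounded) (auto simp: partial_density_bounds)
  moreover have "liminf ?f \<le> limsup ?f" by (rule Liminf_le_Limsup) simp
  ultimately have "liminf ?f = 0" using up by simp
  with up have "?f \<longlonglongrightarrow> 0" by (intro Liminf_eq_Limsup) simp_all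
  then show "coarsely_similar X Y" unfolding coarsely_similar_def
    by (simp add: zero_ereal_def)
qed

lemma upper_density_empty: "upper_density {} = 0"
  by (simp add: upper_density_def partial_density_def Limsup_const flip: zero_ereal_def)

lemma sym_diff_commute: "sym_diff X Y = sym_diff Y X"
  by auto

quotient_type coarse_class = "nat set" / coarsely_similar
proof (rule equivpI)
  show "reflp coarsely_similar"
    by (simp add: reflp_def coarsely_similar_iff upper_density_empty)
  show "symp coarsely_similar"
    by (simp add: symp_def coarsely_similar_def Un_commute)
  show "transp coarsely_similar"
    unfolding transp_def coarsely_similar_iff
    by (metis add.right_neutral antisym upper_density_bounds(1) upper_density_triangle)
qed

instantiation coarse_class :: metric_space
begin

lift_definition dist_coarse_class :: "coarse_class \<Rightarrow> coarse_class \<Rightarrow> real"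
  is "\<lambda>X Y. upper_density (sym_diff X Y)"
proof -
  fix X X' Y Y' :: "nat set"
  assume "coarsely_similar X X'" "coarsely_similar Y Y'"
  then have "upper_density (sym_diff X X') = 0" "upper_density (sym_diff Y Y') = 0"
    "upper_density (sym_diff X' X) = 0" "upper_density (sym_diff Y' Y) = 0"
    by (simp_all add: coarsely_similar_iff Un_commute)
  with upper_density_triangle[of X Y X'] upper_density_triangle[of X' Y Y']
    upper_density_triangle[of X' Y' X] upper_density_triangle[of X Y' Y]
  show "upper_density (sym_diff X Y) = upper_density (sym_diff X' Y')"
    by linarith
qed

definition uniformity_coarse_class :: "(coarse_class \<times> coarse_class) filter" where
  "uniformity_coarse_class = (INF e\<in>{0<..}. principal {(x, y). dist x y < e})"

definition open_coarse_class :: "coarse_class set \<Rightarrow> bool" where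
  "open_coarse_class U \<longleftrightarrow> (\<forall>x\<in>U. \<forall>\<^sub>F (x', y) in uniformity. x' = x \<longrightarrow> y \<in> U)"

instance
proof
  show "dist x y = 0 \<longleftrightarrow> x = y" for x y :: coarse_class
    by transfer (simp add: coarsely_similar_iff)
  show "dist x y \<le> dist x z + dist y z" for x y z :: coarse_class
    by transfer (metis upper_density_triangle sym_diff_commute)
qed (fact uniformity_coarse_class_def open_coarse_class_def)+

end

lemma dist_coarse_class_le_1: "dist x y \<le> 1" for x y :: coarse_class
  by transfer (rule upper_density_bounds)


section \<open>Hausdorff distance between Turing degrees\<close>

text \<open>
  For nonempty bounded sets this is the usual Hausdorff distance. Both conditions hold below:
  distances in the space of coarse similarity classes are at most \<open>1\<close>
  (see \<open>dist_coarse_class_le_1\<close>), and every degree bounds some set.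
\<close>

definition hausdorff_dist :: "'a::metric_space set \<Rightarrow> 'a set \<Rightarrow> real" where
  "hausdorff_dist S T = max (SUP x\<in>S. infdist x T) (SUP y\<in>T. infdist y S)"

definition classes_below :: "turing_degree \<Rightarrow> coarse_class set" where
  "classes_below d = {abs_coarse_class X | X. reducible_to_degree X d}"

definition degree_dist :: "turing_degree \<Rightarrow> turing_degree \<Rightarrow> real" where
  "degree_dist d e = hausdorff_dist (closure (classes_below d)) (closure (classes_below e))"

lemma classes_below_nonempty: "classes_below d \<noteq> {}"
  by (auto simp: classes_below_def) (transfer, blast intro: turing_reducible_refl)

lemma degree_dist_commute: "degree_dist d e = degree_dist e d"
  by (simp add: degree_dist_def hausdorff_dist_def max.commute)

lemma degree_dist_self: "degree_dist d d = 0"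
  using classes_below_nonempty[of d]
  by (simp add: degree_dist_def hausdorff_dist_def)


section \<open>The distance-one-half graph on the Turing degrees\<close>

text \<open>
  An undirected graph is represented, as usual in the graph library, by a digraph with a
  symmetric set of arcs.
\<close>

definition half_graph :: "turing_degree pair_pre_digraph" where
  "half_graph = \<lparr>pverts = UNIV, parcs = {(a, b). degree_dist a b = 1/2}\<rparr>"

text \<open>
  \<open>wf_digraph.\<mu> G (\<lambda>_. 1) u v\<close> is the least number of arcs on a walk from \<open>u\<close> to \<open>v\<close>
  (\<open>\<infinity>\<close> if there is none).
\<close>

definition graph_diameter :: "('a, 'b) pre_digraph \<Rightarrow> ereal" where
  "graph_diameter G = (SUP u\<in>verts G. SUP v\<in>verts G. wf_digraph.\<mu> G (\<lambda>_. 1) u v)"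

lemma half_graph_simple:
  "wf_digraph (with_proj half_graph)" "loopfree_digraph (with_proj half_graph)"
  "nomulti_digraph (with_proj half_graph)" "sym_digraph (with_proj half_graph)"
proof -
  show wf: "wf_digraph (with_proj half_graph)"
    by unfold_locales (auto simp: half_graph_def)
  interpret wf_digraph "with_proj half_graph" by (fact wf)
  show "loopfree_digraph (with_proj half_graph)"
    by unfold_locales (auto simp: half_graph_def degree_dist_self)
  show "nomulti_digraph (with_proj half_graph)"
    by unfold_locales (auto simp: arc_to_ends_def)
  show "sym_digraph (with_proj half_graph)"
    by unfold_locales
      (auto simp: symmetric_def sym_def half_graph_def degree_dist_commute)
qed

end

theory Submission
  imports Defs
begin

text \<open>
  For every set \<open>A\<close> there is a set \<open>Z\<close> such that every set computable from \<open>A \<oplus> Z\<close> is within \<open>1/2\<close>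
  (up to any \<open>\<epsilon>\<close>) of a set computable from \<open>A\<close>, while \<open>Z\<close> behaves like a random set with respect to
  almost every oracle \<open>B\<close>: for almost every \<open>B\<close>, all sets computable from \<open>A \<oplus> B\<close> have distance at
  most \<open>1/2\<close> from \<open>Z\<close>, and (taking complements) exactly \<open>1/2\<close>. Hence \<open>A\<close> and \<open>A \<oplus> Z\<close> are adjacent.
  Given two sets \<open>A\<^sub>1, A\<^sub>2\<close> with such \<open>Z\<^sub>1, Z\<^sub>2\<close>, almost every \<open>B\<close> also has distance \<open>1/2\<close> from every
  set computable from some \<open>A\<^sub>i \<oplus> Z\<^sub>i\<close>, so that \<open>B\<close> is adjacent to both \<open>A\<^sub>i \<oplus> Z\<^sub>i\<close>. This gives the path
  \<open>A\<^sub>1, A\<^sub>1 \<oplus> Z\<^sub>1, B, A\<^sub>2 \<oplus> Z\<^sub>2, A\<^sub>2\<close>.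

  The set \<open>Z\<close> is obtained by forcing with \<open>A\<close>-decidable binary trees of positive density. To treat a
  functional, either force it to diverge somewhere, or find with the help of \<open>A\<close>, block by block, a
  string within \<open>1/2 + \<epsilon>\<close> of the predicted values for all but a summable proportion of the nodes,
  and prune the exceptional nodes. No measure theory is needed: measures are replaced by counting
  nodes, and almost every \<open>B\<close> by a branch of a tree from which summably many nodes are pruned.
\<close>

section \<open>Functions computable from an oracle\<close>

text \<open>The arguments form one list so that closure rules apply by the shape of a term. A bound
  variable of a sum, quantifier or search is pushed to the front, whence the pattern
  \<open>ys ! 0\<close>, \<open>tl ys\<close> in the premises below.\<close>

definition recf :: "nat set \<Rightarrow> nat \<Rightarrow> (nat list \<Rightarrow> nat) \<Rightarrow> bool" where
  "recf A m f \<longleftrightarrow> (\<exists>c. \<forall>xs. length xs = m \<longrightarrow> computes A c xs (f xs))"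

definition decp :: "nat set \<Rightarrow> nat \<Rightarrow> (nat list \<Rightarrow> bool) \<Rightarrow> bool" where
  "decp A m P \<longleftrightarrow> recf A m (\<lambda>xs. of_bool (P xs))"

named_theorems rec_intros

lemma recf_cong: "(\<And>xs. length xs = m \<Longrightarrow> f xs = g xs) \<Longrightarrow> recf A m f = recf A m g"
  by (auto simp: recf_def)

lemma recf_nth [rec_intros]: "i < m \<Longrightarrow> recf A m (\<lambda>xs. xs ! i)"
  unfolding recf_def using computes.proj by blast

lemma recf_compose:
  assumes "recf A (length gs) f" "\<And>g. g \<in> set gs \<Longrightarrow> recf A m g"
  shows "recf A m (\<lambda>xs. f (map (\<lambda>g. g xs) gs))"
proof -
  obtain c where c: "\<And>xs. length xs = length gs \<Longrightarrow> computes A c xs (f xs)"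
    using assms(1) by (auto simp: recf_def)
  obtain d where d: "\<And>g xs. g \<in> set gs \<Longrightarrow> length xs = m \<Longrightarrow> computes A (d g) xs (g xs)"
    using assms(2) unfolding recf_def by metis
  have "computes A (Comp c (map d gs)) xs (f (map (\<lambda>g. g xs) gs))" if "length xs = m" for xs
    by (rule computes.comp[OF _ c])
      (use d that in \<open>auto simp: list_all2_conv_all_nth\<close>)
  then show ?thesis by (auto simp: recf_def)
qed

lemma recf_compose1: "recf A 1 (\<lambda>ys. f (ys ! 0)) \<Longrightarrow> recf A m g \<Longrightarrow> recf A m (\<lambda>xs. f (g xs))"
  using recf_compose[where gs="[g]" and f="\<lambda>ys. f (ys ! 0)"] by simp

lemma recf_compose2:
  "recf A 2 (\<lambda>ys. f (ys ! 0) (ys ! 1)) \<Longrightarrow> recf A m g \<Longrightarrow> recf A m h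
    \<Longrightarrow> recf A m (\<lambda>xs. f (g xs) (h xs))"
  using recf_compose[where gs="[g, h]" and f="\<lambda>ys. f (ys ! 0) (ys ! 1)"]
  by (auto simp: numeral_2_eq_2)

lemma recf_compose3:
  "recf A 3 (\<lambda>ys. f (ys ! 0) (ys ! 1) (ys ! 2)) \<Longrightarrow> recf A m g \<Longrightarrow> recf A m h \<Longrightarrow> recf A m k
    \<Longrightarrow> recf A m (\<lambda>xs. f (g xs) (h xs) (k xs))"
  using recf_compose[where gs="[g, h, k]" and f="\<lambda>ys. f (ys ! 0) (ys ! 1) (ys ! 2)"]
  by (auto simp: numeral_3_eq_3 numeral_2_eq_2)

text \<open>Weakening: a function of the outer variables stays available below a binder. The code
  composes \<open>f\<close> with the projections that skip the new first entry.\<close>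

lemma recf_tl: "recf A m f \<Longrightarrow> recf A (Suc m) (\<lambda>ys. f (tl ys))"
proof -
  assume f: "recf A m f"
  have "recf A (Suc m) (\<lambda>ys. f (map (\<lambda>g. g ys) (map (\<lambda>i ys. ys ! i) [1..<Suc m])))"
    by (rule recf_compose) (use f in \<open>auto intro: rec_intros simp del: upt_Suc\<close>)
  also have "recf A (Suc m) (\<lambda>ys. f (map (\<lambda>g. g ys) (map (\<lambda>i ys. ys ! i) [1..<Suc m])))
    \<longleftrightarrow> recf A (Suc m) (\<lambda>ys. f (tl ys))"
    by (rule recf_cong, rule arg_cong[where f=f])
      (auto simp: list_eq_iff_nth_eq nth_tl simp del: upt_Suc)
  finally show ?thesis .
qed

lemma recf_nth_tl [rec_intros]: "Suc i < m \<Longrightarrow> recf A m (\<lambda>xs. tl xs ! i)"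
  by (cases m) (auto intro: recf_tl rec_intros)

lemma recf_nth_tl_tl [rec_intros]: "Suc (Suc i) < m \<Longrightarrow> recf A m (\<lambda>xs. tl (tl xs) ! i)"
  by (cases m) (auto intro: recf_tl[where f="\<lambda>xs. tl xs ! i"] rec_intros)

lemma recf_Suc [rec_intros]: "recf A m f \<Longrightarrow> recf A m (\<lambda>xs. Suc (f xs))"
proof (rule recf_compose1[where f=Suc])
  show "recf A 1 (\<lambda>ys. Suc (ys ! 0))"
    unfolding recf_def by (rule exI[of _ Succ]) (auto simp: length_Suc_conv intro: computes.succ)
qed

lemma recf_const [rec_intros]: "recf A m (\<lambda>xs. k)"
proof (induction k)
  case 0
  show ?case unfolding recf_def using computes.zero by blast
qed (rule rec_intros)

lemma recf_rec_nat:
  assumes b: "recf A m b" and f: "recf A m f"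
    and g: "recf A (Suc (Suc m)) (\<lambda>ys. g (ys ! 0) (tl ys ! 0) (tl (tl ys)))"
  shows "recf A m (\<lambda>xs. rec_nat (f xs) (\<lambda>k r. g k r xs) (b xs))"
proof -
  obtain c where c: "\<And>xs. length xs = m \<Longrightarrow> computes A c xs (f xs)"
    using f by (auto simp: recf_def)
  obtain d where d: "\<And>ys. length ys = Suc (Suc m)
      \<Longrightarrow> computes A d ys (g (ys ! 0) (tl ys ! 0) (tl (tl ys)))"
    using g by (auto simp: recf_def)
  have "computes A (PrimRec c d) (k # xs) (rec_nat (f xs) (\<lambda>k r. g k r xs) k)"
    if "length xs = m" for k xs
  proof (induction k)
    case 0
    then show ?case using c that by (auto intro: computes.primrec_0)
  next
    case (Suc k)
    show ?case
      by (rule computes.primrec_Suc[OF Suc])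
        (use d[of "k # rec_nat (f xs) (\<lambda>k r. g k r xs) k # xs"] that in simp)
  qed
  then have "recf A (Suc m) (\<lambda>ys. rec_nat (f (tl ys)) (\<lambda>k r. g k r (tl ys)) (ys ! 0))"
    unfolding recf_def by (intro exI[of _ "PrimRec c d"]) (auto simp: length_Suc_conv)
  \<comment> \<open>\<open>PrimRec\<close> recurses on the first entry, so the value of
    \<open>b\<close> is put in front of the unchanged tuple.\<close>
  then have "recf A m (\<lambda>xs. (\<lambda>ys. rec_nat (f (tl ys)) (\<lambda>k r. g k r (tl ys)) (ys ! 0))
      (map (\<lambda>g. g xs) (b # map (\<lambda>i xs. xs ! i) [0..<m])))"
    by (intro recf_compose) (auto intro: rec_intros b)
  also have "?this \<longleftrightarrow> ?thesis"
  proof (rule recf_cong)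
    fix xs :: "nat list" assume "length xs = m"
    then have "map ((\<lambda>g. g xs) \<circ> (\<lambda>i xs. xs ! i)) [0..<m] = xs"
      by (auto simp: list_eq_iff_nth_eq)
    then show "(\<lambda>ys. rec_nat (f (tl ys)) (\<lambda>k r. g k r (tl ys)) (ys ! 0))
        (map (\<lambda>g. g xs) (b # map (\<lambda>i xs. xs ! i) [0..<m])) =
      rec_nat (f xs) (\<lambda>k r. g k r xs) (b xs)" by simp
  qed
  finally show ?thesis .
qed

section \<open>Arithmetic, bounded sums and quantifiers, and search\<close>

lemma recf_add [rec_intros]:
  assumes "recf A m f" "recf A m g" shows "recf A m (\<lambda>xs. f xs + g xs)"
proof -
  have "rec_nat a (\<lambda>_ r. Suc r) b = a + b" for a b by (induction b) auto
  with recf_rec_nat[OF assms(2,1), where g="\<lambda>_ r _. Suc r"] show ?thesis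
    by (simp add: rec_intros)
qed

lemma recf_mult [rec_intros]:
  assumes "recf A m f" "recf A m g" shows "recf A m (\<lambda>xs. f xs * g xs)"
proof -
  have "recf A 2 (\<lambda>xs. rec_nat 0 (\<lambda>_ r. r + xs ! 0) (xs ! 1))"
    by (rule recf_rec_nat) (auto intro!: rec_intros)
  moreover have "rec_nat 0 (\<lambda>_ r. r + a) b = a * b" for a b :: nat by (induction b) auto
  ultimately show ?thesis using recf_compose2[OF _ assms, of times] by simp
qed

lemma recf_power [rec_intros]:
  assumes "recf A m f" "recf A m g" shows "recf A m (\<lambda>xs. f xs ^ g xs)"
proof -
  have "recf A 2 (\<lambda>xs. rec_nat 1 (\<lambda>_ r. r * xs ! 0) (xs ! 1))"
    by (rule recf_rec_nat) (auto intro!: rec_intros)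
  moreover have "rec_nat 1 (\<lambda>_ r. r * a) b = a ^ b" for a b :: nat by (induction b) auto
  ultimately show ?thesis using recf_compose2[OF _ assms, of power] by simp
qed

lemma recf_pred: "recf A m f \<Longrightarrow> recf A m (\<lambda>xs. f xs - 1)"
proof -
  assume f: "recf A m f"
  have "rec_nat 0 (\<lambda>k _. k) b = b - 1" for b by (cases b) auto
  with recf_rec_nat[OF f, of "\<lambda>_. 0" "\<lambda>k _ _. k"] show ?thesis
    by (simp add: rec_intros)
qed

lemma recf_diff [rec_intros]:
  assumes "recf A m f" "recf A m g" shows "recf A m (\<lambda>xs. f xs - g xs)"
proof -
  have "rec_nat a (\<lambda>_ r. r - 1) b = a - b" for a b :: nat by (induction b) auto
  with recf_rec_nat[OF assms(2,1), where g="\<lambda>_ r _. r - 1"] show ?thesis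
    by (simp add: rec_intros recf_pred del: One_nat_def)
qed

lemma recf_of_bool [rec_intros]: "decp A m P \<Longrightarrow> recf A m (\<lambda>xs. of_bool (P xs))"
  by (simp add: decp_def)

lemma decp_not [rec_intros]: "decp A m P \<Longrightarrow> decp A m (\<lambda>xs. \<not> P xs)"
proof -
  assume P: "decp A m P"
  have "(of_bool (\<not> Q) :: nat) = 1 - of_bool Q" for Q by simp
  then show ?thesis unfolding decp_def by (simp only:) (intro rec_intros P)
qed

lemma decp_conj [rec_intros]:
  assumes "decp A m P" "decp A m Q" shows "decp A m (\<lambda>xs. P xs \<and> Q xs)"
  unfolding decp_def of_bool_conj by (intro rec_intros assms)

lemma decp_disj [rec_intros]:
  assumes "decp A m P" "decp A m Q" shows "decp A m (\<lambda>xs. P xs \<or> Q xs)"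
  using decp_not[OF decp_conj[OF assms[THEN decp_not]]] by simp

lemma decp_imp [rec_intros]: "decp A m P \<Longrightarrow> decp A m Q \<Longrightarrow> decp A m (\<lambda>xs. P xs \<longrightarrow> Q xs)"
  unfolding imp_conv_disj by (intro rec_intros)

lemma decp_le [rec_intros]:
  assumes "recf A m f" "recf A m g" shows "decp A m (\<lambda>xs. f xs \<le> g xs)"
proof -
  have "of_bool (a \<le> b) = 1 - (a - b)" for a b :: nat by auto
  with assms show ?thesis unfolding decp_def by (simp only:) (intro rec_intros)
qed

lemma decp_less [rec_intros]: "recf A m f \<Longrightarrow> recf A m g \<Longrightarrow> decp A m (\<lambda>xs. f xs < g xs)"
  unfolding less_eq_Suc_le by (intro rec_intros)

lemma decp_eq [rec_intros]: "recf A m f \<Longrightarrow> recf A m g \<Longrightarrow> decp A m (\<lambda>xs. f xs = g xs)"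
  unfolding order_eq_iff by (intro rec_intros)

lemma recf_If [rec_intros]:
  assumes "decp A m P" "recf A m f" "recf A m g"
  shows "recf A m (\<lambda>xs. if P xs then f xs else g xs)"
proof -
  have "(if Q then a else b) = of_bool Q * a + of_bool (\<not> Q) * b" for Q and a b :: nat by simp
  with assms show ?thesis by (simp only:) (intro rec_intros)
qed

text \<open>Bounded sums carry the rest of the toolkit: cardinalities, bounded quantifiers and
  division are all reduced to them.\<close>

lemma recf_sum [rec_intros]:
  assumes b: "recf A m b" and f: "recf A (Suc m) (\<lambda>ys. f (ys ! 0) (tl ys))"
  shows "recf A m (\<lambda>xs. \<Sum>i<b xs. f i xs)"
proof -
  have eq: "rec_nat 0 (\<lambda>i r. r + f i xs) k = (\<Sum>i<k. f i xs)" for k xs by (induction k) auto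
  \<comment> \<open>The recursion step also receives the accumulator as second entry; composing with
    the projections 0, 2, 3, ... hides it from \<open>f\<close>.\<close>
  have "recf A (Suc (Suc m)) (\<lambda>ys. (\<lambda>zs. f (zs ! 0) (tl zs))
      (map (\<lambda>g. g ys) ((\<lambda>ys. ys ! 0) # map (\<lambda>i ys. ys ! i) [2..<Suc (Suc m)])))"
    by (rule recf_compose) (use f in \<open>auto intro: rec_intros simp del: upt_Suc\<close>)
  also have "?this \<longleftrightarrow> recf A (Suc (Suc m)) (\<lambda>ys. f (ys ! 0) (tl (tl ys)))"
  proof (rule recf_cong)
    fix ys :: "nat list" assume ys: "length ys = Suc (Suc m)"
    then have "map ((\<lambda>g. g ys) \<circ> (\<lambda>i ys. ys ! i)) [2..<Suc (Suc m)] = tl (tl ys)"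
      by (auto simp: list_eq_iff_nth_eq nth_tl simp del: upt_Suc)
    then show "(\<lambda>zs. f (zs ! 0) (tl zs))
        (map (\<lambda>g. g ys) ((\<lambda>ys. ys ! 0) # map (\<lambda>i ys. ys ! i) [2..<Suc (Suc m)]))
      = f (ys ! 0) (tl (tl ys))" by simp
  qed
  finally have f': "recf A (Suc (Suc m)) (\<lambda>ys. f (ys ! 0) (tl (tl ys)))" .
  have "recf A m (\<lambda>xs. rec_nat 0 (\<lambda>i r. r + f i xs) (b xs))"
    by (intro recf_rec_nat b rec_intros f') auto
  then show ?thesis unfolding eq .
qed

lemma card_less_eq_sum: "card {i. i < b \<and> P i} = (\<Sum>i<b. of_bool (P i))" for b :: nat
  by (simp add: of_bool_def sum.If_cases) (auto intro: arg_cong[where f=card])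

lemma recf_card [rec_intros]:
  assumes "recf A m b" "decp A (Suc m) (\<lambda>ys. P (ys ! 0) (tl ys))"
  shows "recf A m (\<lambda>xs. card {i. i < b xs \<and> P i xs})"
  unfolding card_less_eq_sum by (intro rec_intros assms)

lemma decp_bex [rec_intros]:
  assumes "recf A m b" "decp A (Suc m) (\<lambda>ys. P (ys ! 0) (tl ys))"
  shows "decp A m (\<lambda>xs. \<exists>i<b xs. P i xs)"
proof -
  have "(\<exists>i<b xs. P i xs) \<longleftrightarrow> 0 < (\<Sum>i<b xs. of_bool (P i xs) :: nat)" for xs
    by (auto simp flip: card_less_eq_sum simp: card_gt_0_iff)
  then show ?thesis by (simp only:) (intro rec_intros assms)
qed

lemma decp_ball [rec_intros]:
  assumes "recf A m b" "decp A (Suc m) (\<lambda>ys. P (ys ! 0) (tl ys))"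
  shows "decp A m (\<lambda>xs. \<forall>i<b xs. P i xs)"
proof -
  have "decp A m (\<lambda>xs. \<not> (\<exists>i<b xs. \<not> P i xs))" by (intro rec_intros assms)
  then show ?thesis by simp
qed

lemma recf_Least:
  assumes P: "decp A (Suc m) (\<lambda>ys. P (ys ! 0) (tl ys))"
    and ex: "\<And>xs. length xs = m \<Longrightarrow> \<exists>n. P n xs"
  shows "recf A m (\<lambda>xs. LEAST n. P n xs)"
proof -
  \<comment> \<open>\<open>Mu\<close> searches for a zero, so the code has to decide the negation of
    \<open>P\<close>.\<close>
  obtain c where c: "\<And>ys. length ys = Suc m
      \<Longrightarrow> computes A c ys (of_bool (\<not> P (ys ! 0) (tl ys)))"
    using decp_not[OF P] by (auto simp: recf_def decp_def)
  have "computes A (Mu c) xs (LEAST n. P n xs)" if "length xs = m" for xs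
  proof (rule computes.mu)
    show "computes A c ((LEAST n. P n xs) # xs) 0"
      using c[of "(LEAST n. P n xs) # xs"] LeastI_ex[OF ex[OF that]] that by simp
    fix k assume "k < (LEAST n. P n xs)"
    then have "\<not> P k xs" by (rule not_less_Least)
    then show "\<exists>y>0. computes A c (k # xs) y"
      using c[of "k # xs"] that by auto
  qed
  then show ?thesis by (auto simp: recf_def)
qed

lemma recf_div [rec_intros]:
  assumes "recf A m f" "recf A m g" shows "recf A m (\<lambda>xs. f xs div g xs)"
proof -
  \<comment> \<open>Division counts the positive multiples of \<open>b\<close> up to
    \<open>a\<close>; the conjunct \<open>0 < b\<close> reproduces
    \<open>a div 0 = 0\<close>.\<close>
  have eq: "a div b = (\<Sum>i<a. of_bool (0 < b \<and> Suc i * b \<le> a))" for a b :: nat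
  proof (cases "b = 0")
    case False
    have "{i. i < a \<and> 0 < b \<and> Suc i * b \<le> a} = {..<a div b}"
      using False by (auto simp: less_eq_div_iff_mult_less_eq simp flip: Suc_le_eq)
        (metis Suc_le_eq div_le_dividend le_trans less_eq_div_iff_mult_less_eq mult_Suc)
    then show ?thesis by (simp flip: card_less_eq_sum)
  qed simp
  have "recf A 2 (\<lambda>xs. \<Sum>i<xs ! 0. of_bool (0 < xs ! 1 \<and> Suc i * xs ! 1 \<le> xs ! 0))"
    by (intro rec_intros) auto
  then show ?thesis using recf_compose2[OF _ assms, of "(div)"] unfolding eq by blast
qed

lemma decp_odd [rec_intros]: "recf A m f \<Longrightarrow> decp A m (\<lambda>xs. odd (f xs))"
proof -
  have "odd a \<longleftrightarrow> a div 2 * 2 \<noteq> a" for a :: nat by presburger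
  then show "recf A m f \<Longrightarrow> ?thesis" by (simp only:) (intro rec_intros)
qed

lemma decp_even [rec_intros]: "recf A m f \<Longrightarrow> decp A m (\<lambda>xs. even (f xs))"
  using decp_not[OF decp_odd, of A m f] by simp

lemma recf_take_bit [rec_intros]:
  "recf A m f \<Longrightarrow> recf A m g \<Longrightarrow> recf A m (\<lambda>xs. take_bit (f xs) (g xs))"
  unfolding take_bit_eq_mod minus_div_mult_eq_mod[symmetric] by (intro rec_intros)

lemma decp_bit [rec_intros]: "recf A m f \<Longrightarrow> recf A m g \<Longrightarrow> decp A m (\<lambda>xs. bit (f xs) (g xs))"
  unfolding bit_iff_odd by (intro rec_intros)

lemma turing_reducible_iff_decp: "X \<le>\<^sub>T A \<longleftrightarrow> decp A 1 (\<lambda>xs. xs ! 0 \<in> X)"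
proof -
  have "(\<forall>xs. length xs = 1 \<longrightarrow> Q xs) \<longleftrightarrow> (\<forall>x. Q [x])" for Q :: "nat list \<Rightarrow> bool"
    by (auto simp: length_Suc_conv)
  then show ?thesis by (simp add: turing_reducible_def decp_def recf_def)
qed

lemma decp_oracle [rec_intros]: "recf A m f \<Longrightarrow> decp A m (\<lambda>xs. f xs \<in> A)"
  using turing_reducible_refl[of A] recf_compose1[of A "\<lambda>x. of_bool (x \<in> A)" m f]
  by (simp add: turing_reducible_iff_decp decp_def)

section \<open>Evaluation with a finite part of the oracle\<close>

definition join :: "nat set \<Rightarrow> nat set \<Rightarrow> nat set" where
  "join A Z = {x. if even x then x div 2 \<in> A else x div 2 \<in> Z}"

lemma le_join: "A \<le>\<^sub>T join A Z" "Z \<le>\<^sub>T join A Z"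
proof -
  have "decp (join A Z) 1 (\<lambda>xs. 2 * xs ! 0 \<in> join A Z)" by (intro rec_intros) simp
  then show "A \<le>\<^sub>T join A Z" by (simp add: turing_reducible_iff_decp join_def)
  have "decp (join A Z) 1 (\<lambda>xs. Suc (2 * xs ! 0) \<in> join A Z)" by (intro rec_intros) simp
  then show "Z \<le>\<^sub>T join A Z" by (simp add: turing_reducible_iff_decp join_def)
qed

text \<open>
  The result \<open>0\<close> means undefined and \<open>Suc y\<close> means the value \<open>y\<close>. The number \<open>\<sigma>\<close> encodes the first \<open>n\<close>
  bits of the right component of the oracle; \<open>n\<close> also bounds every unbounded search.
\<close>

primrec ev :: "nat set \<Rightarrow> nat \<Rightarrow> nat \<Rightarrow> ocode \<Rightarrow> nat list \<Rightarrow> nat" where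
  "ev A \<sigma> n Zero = (\<lambda>xs. 1)"
| "ev A \<sigma> n Succ = (\<lambda>xs. if length xs = 1 then Suc (Suc (xs ! 0)) else 0)"
| "ev A \<sigma> n (Proj i) = (\<lambda>xs. if i < length xs then Suc (xs ! i) else 0)"
| "ev A \<sigma> n Oracle = (\<lambda>xs. if length xs \<noteq> 1 then 0
     else if even (xs ! 0) then Suc (of_bool (xs ! 0 div 2 \<in> A))
     else if xs ! 0 div 2 < n then Suc (of_bool (bit \<sigma> (xs ! 0 div 2))) else 0)"
| "ev A \<sigma> n (Comp f gs) = (\<lambda>xs. if \<forall>h\<in>set (map (ev A \<sigma> n) gs). h xs \<noteq> 0
     then ev A \<sigma> n f (map (\<lambda>h. h xs - 1) (map (ev A \<sigma> n) gs)) else 0)"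
| "ev A \<sigma> n (PrimRec f g) = (\<lambda>xs. if xs = [] then 0
     else rec_nat (ev A \<sigma> n f (tl xs))
       (\<lambda>k r. if r = 0 then 0 else ev A \<sigma> n g (k # (r - 1) # tl xs)) (hd xs))"
| "ev A \<sigma> n (Mu f) = (\<lambda>xs. \<Sum>k<n.
     of_bool (ev A \<sigma> n f (k # xs) = 1 \<and> (\<forall>j<k. 1 < ev A \<sigma> n f (j # xs))) * Suc k)"

declare ev.simps(6,7) [simp del]

lemma ev_PrimRec [simp]:
  "ev A \<sigma> n (PrimRec f g) [] = 0"
  "ev A \<sigma> n (PrimRec f g) (0 # xs) = ev A \<sigma> n f xs"
  "ev A \<sigma> n (PrimRec f g) (Suc k # xs) = (let r = ev A \<sigma> n (PrimRec f g) (k # xs)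
     in if r = 0 then 0 else ev A \<sigma> n g (k # (r - 1) # xs))"
  by (simp_all add: ev.simps(6) Let_def cong: if_cong)

text \<open>At most one summand is nonzero. This is why the sum in the \<open>Mu\<close> clause of
  \<open>ev\<close> returns either \<open>Suc\<close> of the index found or 0 for failure.\<close>

lemma sum_unique_Suc:
  fixes P :: "nat \<Rightarrow> bool"
  assumes uniq: "\<And>i j. P i \<Longrightarrow> P j \<Longrightarrow> i = j"
  shows "(\<Sum>k<n. of_bool (P k) * Suc k) = Suc j \<longleftrightarrow> j < n \<and> P j"
proof -
  have *: "(\<Sum>k<n. of_bool (P k) * Suc k) = of_bool (i < n) * Suc i" if "P i" for i
  proof -
    have P: "P k \<longleftrightarrow> k = i" for k using that uniq by blast
    have "(\<Sum>k<n. of_bool (P k) * Suc k) = (\<Sum>k<n. if k = i then Suc k else 0)"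
      unfolding P by (intro sum.cong) auto
    then show ?thesis by simp
  qed
  show ?thesis
  proof (cases "\<exists>i. P i")
    case True
    then obtain i where i: "P i" by blast
    have "of_bool (i < n) * Suc i = Suc j \<longleftrightarrow> j < n \<and> i = j" by auto
    moreover have "i = j \<longleftrightarrow> P j" using i uniq by blast
    ultimately show ?thesis unfolding *[OF i] by blast
  next
    case False
    then show ?thesis by simp
  qed
qed

text \<open>The result 1 codes the value 0 and larger results code positive values, so this is the
  semantics of \<open>Mu\<close> with the search cut off at \<open>n\<close>.\<close>

lemma ev_Mu: "ev A \<sigma> n (Mu f) xs = Suc k \<longleftrightarrow>
  k < n \<and> ev A \<sigma> n f (k # xs) = 1 \<and> (\<forall>j<k. 1 < ev A \<sigma> n f (j # xs))"
  unfolding ev.simps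
proof (rule sum_unique_Suc)
  fix i j
  assume i: "ev A \<sigma> n f (i # xs) = 1 \<and> (\<forall>k<i. 1 < ev A \<sigma> n f (k # xs))"
    and j: "ev A \<sigma> n f (j # xs) = 1 \<and> (\<forall>k<j. 1 < ev A \<sigma> n f (k # xs))"
  from i j have "\<not> i < j" "\<not> j < i" by auto
  then show "i = j" by simp
qed

text \<open>The use principle: \<open>ev\<close> never consults bits from \<open>n\<close> on. Hence
  divergence passes to initial segments, and wrong answers pass to extensions.\<close>

lemma ev_mono:
  assumes "n \<le> n'" "\<And>i. i < n \<Longrightarrow> bit \<sigma>' i = bit \<sigma> i"
  shows "ev A \<sigma> n c xs = Suc y \<Longrightarrow> ev A \<sigma>' n' c xs = Suc y"
proof (induction c arbitrary: xs y)
  case Oracle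
  then show ?case using assms by (auto split: if_splits)
next
  case (Comp f gs)
  have 1: "ev A \<sigma> n g xs \<noteq> 0" if "g \<in> set gs" for g
    using Comp.prems that by (auto split: if_splits)
  then have "ev A \<sigma>' n' g xs = ev A \<sigma> n g xs" if "g \<in> set gs" for g
    using Comp.IH(2)[OF that, of xs "ev A \<sigma> n g xs - 1"] that by simp
  with 1 have "map (\<lambda>h. h xs - 1) (map (ev A \<sigma>' n') gs) = map (\<lambda>h. h xs - 1) (map (ev A \<sigma> n) gs)"
    "\<forall>h\<in>set (map (ev A \<sigma>' n') gs). h xs \<noteq> 0" by auto
  moreover have "ev A \<sigma> n f (map (\<lambda>h. h xs - 1) (map (ev A \<sigma> n) gs)) = Suc y"
    using Comp.prems by (auto split: if_splits)
  ultimately show ?case using Comp.IH(1) by (simp del: map_map)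
next
  case (PrimRec f g)
  obtain k zs where xs: "xs = k # zs" using PrimRec.prems by (cases xs) auto
  have "ev A \<sigma> n (PrimRec f g) (k # zs) = Suc y \<Longrightarrow> ev A \<sigma>' n' (PrimRec f g) (k # zs) = Suc y"
  proof (induction k arbitrary: y)
    case (Suc k)
    let ?e = "ev A \<sigma> n (PrimRec f g) (k # zs)"
    from Suc.prems have e: "?e \<noteq> 0" "ev A \<sigma> n g (k # (?e - 1) # zs) = Suc y"
      by (simp_all add: Let_def split: if_splits)
    moreover have "ev A \<sigma>' n' (PrimRec f g) (k # zs) = ?e"
      using Suc.IH[of "?e - 1"] \<open>?e \<noteq> 0\<close> by simp
    moreover have "ev A \<sigma>' n' g (k # (?e - 1) # zs) = Suc y"
      by (rule PrimRec.IH(2)) fact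
    ultimately show ?case by (simp add: Let_def)
  qed (use PrimRec.IH(1) in simp)
  with PrimRec.prems xs show ?case by simp
next
  case (Mu f)
  have "1 < ev A \<sigma>' n' f (j # xs)" if "1 < ev A \<sigma> n f (j # xs)" for j
    using Mu.IH[of "j # xs" "ev A \<sigma> n f (j # xs) - 1"] that by simp
  moreover have "ev A \<sigma>' n' f (j # xs) = 1" if "ev A \<sigma> n f (j # xs) = 1" for j
    using Mu.IH[of "j # xs" 0] that by simp
  ultimately show ?case using Mu.prems assms(1) unfolding ev_Mu by fastforce
qed auto

lemma ev_sound:
  assumes Z: "\<And>i. i < n \<Longrightarrow> bit \<sigma> i \<longleftrightarrow> i \<in> Z"
  shows "ev A \<sigma> n c xs = Suc y \<Longrightarrow> computes (join A Z) c xs y"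
proof (induction c arbitrary: xs y)
  case Zero
  then show ?case by (auto intro: computes.intros)
next
  case Succ
  then show ?case by (auto intro: computes.intros simp: length_Suc_conv split: if_splits)
next
  case (Proj i)
  then show ?case by (auto intro: computes.intros split: if_splits)
next
  case Oracle
  then obtain x where "xs = [x]" by (auto simp: length_Suc_conv split: if_splits)
  moreover have "y = of_bool (x \<in> join A Z)"
    using Oracle Z calculation by (auto simp: join_def split: if_splits)
  ultimately show ?case using computes.query by blast
next
  case (Comp f gs)
  have 1: "ev A \<sigma> n g xs \<noteq> 0" if "g \<in> set gs" for g
    using Comp.prems that by (auto split: if_splits)
  have "computes (join A Z) f (map (\<lambda>h. h xs - 1) (map (ev A \<sigma> n) gs)) y"
    using Comp.prems by (auto intro!: Comp.IH(1) split: if_splits)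
  then show ?case
    by (rule computes.comp[rotated])
      (use 1 Comp.IH(2) in \<open>auto simp: list_all2_conv_all_nth\<close>)
next
  case (PrimRec f g)
  obtain k zs where xs: "xs = k # zs" using PrimRec.prems by (cases xs) auto
  have "ev A \<sigma> n (PrimRec f g) (k # zs) = Suc y \<Longrightarrow> computes (join A Z) (PrimRec f g) (k # zs) y"
  proof (induction k arbitrary: y)
    case 0
    then show ?case using PrimRec.IH(1) by (auto intro: computes.intros)
  next
    case (Suc k)
    let ?e = "ev A \<sigma> n (PrimRec f g) (k # zs)"
    from Suc.prems have e: "?e \<noteq> 0" "ev A \<sigma> n g (k # (?e - 1) # zs) = Suc y"
      by (simp_all add: Let_def split: if_splits)
    then have "computes (join A Z) (PrimRec f g) (k # zs) (?e - 1)"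
      by (intro Suc.IH) simp
    moreover have "computes (join A Z) g (k # (?e - 1) # zs) y"
      by (rule PrimRec.IH(2)) fact
    ultimately show ?case by (rule computes.primrec_Suc)
  qed
  with PrimRec.prems xs show ?case by simp
next
  case (Mu f)
  then have y: "y < n" "ev A \<sigma> n f (y # xs) = 1" "\<And>j. j < y \<Longrightarrow> 1 < ev A \<sigma> n f (j # xs)"
    by (auto simp: ev_Mu)
  show ?case
  proof (rule computes.mu)
    show "computes (join A Z) f (y # xs) 0" using Mu.IH y(2) by simp
    fix j assume "j < y"
    with y(3) have "1 < ev A \<sigma> n f (j # xs)" by blast
    with Mu.IH[of "j # xs" "ev A \<sigma> n f (j # xs) - 1"]
    show "\<exists>v>0. computes (join A Z) f (j # xs) v"
      by (intro exI[of _ "ev A \<sigma> n f (j # xs) - 1"]) simp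
  qed
qed

definition approximates :: "nat \<Rightarrow> nat \<Rightarrow> nat set \<Rightarrow> bool" where
  "approximates \<sigma> n Z \<longleftrightarrow> (\<forall>i<n. bit \<sigma> i \<longleftrightarrow> i \<in> Z)"

text \<open>A halting computation asks finitely many questions and makes bounded searches. The
  threshold covers all larger \<open>n'\<close>, so that thresholds of finitely many subcomputations
  can be combined.\<close>

lemma ev_complete:
  "computes (join A Z) c xs y \<Longrightarrow> \<exists>n. \<forall>\<sigma> n'. n \<le> n' \<longrightarrow> approximates \<sigma> n' Z \<longrightarrow> ev A \<sigma> n' c xs = Suc y"
proof (induction rule: computes.induct)
  case (query x)
  show ?case
    by (rule exI[of _ "Suc x"]) (auto simp: approximates_def join_def)
next
  case (comp xs gs ys f z)
  from comp.IH(2) obtain n0 where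
    n0: "\<And>\<sigma> n'. n0 \<le> n' \<Longrightarrow> approximates \<sigma> n' Z \<Longrightarrow> ev A \<sigma> n' f ys = Suc z" by blast
  have len: "length gs = length ys" using comp.IH(1) by (rule list_all2_lengthD)
  have "\<forall>i<length gs. \<exists>n. \<forall>\<sigma> n'. n \<le> n' \<longrightarrow> approximates \<sigma> n' Z \<longrightarrow> ev A \<sigma> n' (gs ! i) xs = Suc (ys ! i)"
    using comp.IH(1) by (auto simp: list_all2_conv_all_nth)
  then obtain N where N: "\<And>i \<sigma> n'. i < length gs \<Longrightarrow> N i \<le> n' \<Longrightarrow> approximates \<sigma> n' Z
      \<Longrightarrow> ev A \<sigma> n' (gs ! i) xs = Suc (ys ! i)" by metis
  define M where "M = n0 + (\<Sum>i<length gs. N i)"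
  have M: "N i \<le> M" if "i < length gs" for i
    unfolding M_def using that member_le_sum[of i "{..<length gs}" N] by simp
  show ?case
  proof (intro exI[of _ M] allI impI)
    fix \<sigma> n' assume n': "M \<le> n'" "approximates \<sigma> n' Z"
    have *: "ev A \<sigma> n' (gs ! i) xs = Suc (ys ! i)" if "i < length gs" for i
      using N[OF that _ n'(2)] M[OF that] n'(1) by simp
    have "map (\<lambda>h. h xs - 1) (map (ev A \<sigma> n') gs) = ys"
      using * len by (auto simp: list_eq_iff_nth_eq)
    moreover have "\<forall>h\<in>set (map (ev A \<sigma> n') gs). h xs \<noteq> 0"
      using * by (auto simp: in_set_conv_nth)
    moreover have "ev A \<sigma> n' f ys = Suc z" using n0 n' by (simp add: M_def)
    ultimately show "ev A \<sigma> n' (Comp f gs) xs = Suc z" by (simp del: map_map)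
  qed
next
  case (primrec_Suc f g n xs r y)
  then obtain n1 n2 where
    "\<And>\<sigma> n'. n1 \<le> n' \<Longrightarrow> approximates \<sigma> n' Z \<Longrightarrow> ev A \<sigma> n' (PrimRec f g) (n # xs) = Suc r"
    "\<And>\<sigma> n'. n2 \<le> n' \<Longrightarrow> approximates \<sigma> n' Z \<Longrightarrow> ev A \<sigma> n' g (n # r # xs) = Suc y"
    by blast
  then show ?case by (intro exI[of _ "max n1 n2"]) simp
next
  case (mu f k xs)
  from mu.IH(1) obtain n0 where
    n0: "\<And>\<sigma> n'. n0 \<le> n' \<Longrightarrow> approximates \<sigma> n' Z \<Longrightarrow> ev A \<sigma> n' f (k # xs) = Suc 0" by blast
  have "\<forall>j. \<exists>n. j < k \<longrightarrow> (\<forall>\<sigma> n'. n \<le> n' \<longrightarrow> approximates \<sigma> n' Z \<longrightarrow> 1 < ev A \<sigma> n' f (j # xs))"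
  proof
    fix j show "\<exists>n. j < k \<longrightarrow> (\<forall>\<sigma> n'. n \<le> n' \<longrightarrow> approximates \<sigma> n' Z \<longrightarrow> 1 < ev A \<sigma> n' f (j # xs))"
    proof (cases "j < k")
      case True
      from mu.IH(2)[OF this] obtain y n where "y > 0"
        "\<And>\<sigma> n'. n \<le> n' \<Longrightarrow> approximates \<sigma> n' Z \<Longrightarrow> ev A \<sigma> n' f (j # xs) = Suc y" by blast
      then show ?thesis by (intro exI[of _ n]) simp
    qed simp
  qed
  from choice[OF this] obtain N where "\<forall>j. j < k \<longrightarrow> (\<forall>\<sigma> n'. N j \<le> n'
      \<longrightarrow> approximates \<sigma> n' Z \<longrightarrow> 1 < ev A \<sigma> n' f (j # xs))" ..
  then have N: "1 < ev A \<sigma> n' f (j # xs)" if "j < k" "N j \<le> n'" "approximates \<sigma> n' Z" for j \<sigma> n'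
    using that by blast
  \<comment> \<open>\<open>Suc k\<close> lets the bounded search reach its answer \<open>k\<close>;
    the sum dominates every threshold \<open>N i\<close> with \<open>i < k\<close>.\<close>
  define M where "M = Suc k + n0 + (\<Sum>i<k. N i)"
  have M: "N i \<le> M" if "i < k" for i
    unfolding M_def using that member_le_sum[of i "{..<k}" N] by simp
  show ?case
  proof (intro exI[of _ M] allI impI)
    fix \<sigma> n' assume n': "M \<le> n'" "approximates \<sigma> n' Z"
    have "1 < ev A \<sigma> n' f (j # xs)" if "j < k" for j
      by (rule N[OF that le_trans[OF M[OF that] n'(1)] n'(2)])
    moreover have "k < n'" "ev A \<sigma> n' f (k # xs) = Suc 0"
      using n' by (simp_all add: M_def n0)
    ultimately show "ev A \<sigma> n' (Mu f) xs = Suc k"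
      unfolding ev_Mu by simp
  qed
qed auto

lemma decp_ball_set:
  "(\<And>h. h \<in> set hs \<Longrightarrow> decp A m (P h)) \<Longrightarrow> decp A m (\<lambda>xs. \<forall>h\<in>set hs. P h xs)"
proof (induction hs)
  case Nil
  then show ?case by (simp add: decp_def rec_intros)
qed (simp add: rec_intros)

text \<open>The code is fixed while string, stage and arguments vary. The arguments are a list of
  functions, with \<open>m\<close> arbitrary, because subcodes are run on longer tuples that contain
  bound variables.\<close>

lemma recf_ev_list:
  assumes "recf A m a" "recf A m b" "\<And>g. g \<in> set gs \<Longrightarrow> recf A m g"
  shows "recf A m (\<lambda>xs. ev A (a xs) (b xs) c (map (\<lambda>g. g xs) gs))"
  using assms
proof (induction c arbitrary: m a b gs)
  case Zero
  show ?case by (simp add: rec_intros)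
next
  case Succ
  show ?case
  proof (cases "length gs = 1")
    case True
    then obtain g where gs: "gs = [g]" by (auto simp: length_Suc_conv)
    then have g: "recf A m g" using Succ.prems by simp
    have "recf A m (\<lambda>xs. Suc (Suc (g xs)))" by (intro rec_intros g)
    then show ?thesis by (simp add: gs)
  qed (use Succ in \<open>simp add: rec_intros\<close>)
next
  case (Proj i)
  then show ?case by (cases "i < length gs") (auto intro!: rec_intros)
next
  case Oracle
  show ?case
  proof (cases "length gs = 1")
    case True
    then obtain g where gs: "gs = [g]" by (auto simp: length_Suc_conv)
    then have g: "recf A m g" using Oracle.prems by simp
    have "recf A m (\<lambda>xs. if even (g xs) then Suc (of_bool (g xs div 2 \<in> A))
        else if g xs div 2 < b xs then Suc (of_bool (bit (a xs) (g xs div 2))) else 0)"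
      by (intro rec_intros Oracle.prems(1,2) g)
    then show ?thesis by (simp add: gs cong: if_cong)
  qed (use Oracle in \<open>simp add: rec_intros\<close>)
next
  case (Comp f hs)
  have h: "recf A m (\<lambda>xs. ev A (a xs) (b xs) h (map (\<lambda>g. g xs) gs))" if "h \<in> set hs" for h
    by (rule Comp.IH(2)[OF that Comp.prems])
  have "recf A m (\<lambda>xs. ev A (a xs) (b xs) f (map (\<lambda>g. g xs)
      (map (\<lambda>h xs. ev A (a xs) (b xs) h (map (\<lambda>g. g xs) gs) - 1) hs)))"
    by (rule Comp.IH(1)) (use Comp.prems(1,2) in \<open>auto intro!: recf_pred[simplified] h\<close>)
  moreover have "decp A m (\<lambda>xs. \<forall>h\<in>set hs. ev A (a xs) (b xs) h (map (\<lambda>g. g xs) gs) \<noteq> 0)"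
    by (intro decp_ball_set rec_intros h)
  ultimately have "recf A m (\<lambda>xs. if \<forall>h\<in>set hs. ev A (a xs) (b xs) h (map (\<lambda>g. g xs) gs) \<noteq> 0
    then ev A (a xs) (b xs) f (map (\<lambda>g. g xs)
      (map (\<lambda>h xs. ev A (a xs) (b xs) h (map (\<lambda>g. g xs) gs) - 1) hs)) else 0)"
    by (intro recf_If recf_const)
  then show ?case by (simp add: comp_def cong: if_cong)
next
  case (PrimRec f g)
  show ?case
  proof (cases gs)
    case Nil
    then show ?thesis by (simp add: recf_const)
  next
    case (Cons g0 gs')
    let ?tl = "\<lambda>h ys. h (tl (tl ys))"
    have tl: "recf A (Suc (Suc m)) (?tl h)" if "recf A m h" for h
      using recf_tl[OF recf_tl[OF that]] .
    have hd0: "recf A (Suc (Suc m)) (\<lambda>ys. ys ! 0)" by (intro rec_intros) simp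
    have hd1: "recf A (Suc (Suc m)) (\<lambda>ys. tl ys ! 0 - 1)" by (intro rec_intros) simp
    have "recf A (Suc (Suc m)) (\<lambda>ys. ev A (?tl a ys) (?tl b ys) g
        (map (\<lambda>g. g ys) ((\<lambda>ys. ys ! 0) # (\<lambda>ys. tl ys ! 0 - 1) # map ?tl gs')))"
      by (rule PrimRec.IH(2)) (use PrimRec.prems Cons hd0 hd1 in \<open>auto intro: tl\<close>)
    then have 1: "recf A (Suc (Suc m)) (\<lambda>ys. ev A (a (tl (tl ys))) (b (tl (tl ys))) g
        (ys ! 0 # (tl ys ! 0 - 1) # map (\<lambda>g. g (tl (tl ys))) gs'))"
      by (simp only: list.map map_map comp_def)
    have 2: "recf A (Suc (Suc m)) (\<lambda>ys. if tl ys ! 0 = 0 then 0 else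
        ev A (a (tl (tl ys))) (b (tl (tl ys))) g
        (ys ! 0 # (tl ys ! 0 - 1) # map (\<lambda>g. g (tl (tl ys))) gs'))"
      by (intro recf_If 1 decp_eq recf_const recf_nth_tl) simp
    have 3: "recf A m (\<lambda>xs. ev A (a xs) (b xs) f (map (\<lambda>g. g xs) gs'))"
      by (rule PrimRec.IH(1)) (use PrimRec.prems Cons in simp_all)
    have "recf A m g0" using PrimRec.prems Cons by simp
    from recf_rec_nat[OF this 3, where g="\<lambda>k r xs. if r = 0 then 0
      else ev A (a xs) (b xs) g (k # (r - 1) # map (\<lambda>g. g xs) gs')", OF 2]
    show ?thesis unfolding Cons ev.simps list.map list.sel by simp
  qed
next
  case (Mu f)
  have hd: "recf A (Suc k) (\<lambda>ys. ys ! 0)" for k by (intro rec_intros) simp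
  let ?tl = "\<lambda>h ys. h (tl ys)"
  have 1: "recf A (Suc m) (\<lambda>ys. ev A (?tl a ys) (?tl b ys) f (map (\<lambda>g. g ys) ((\<lambda>ys. ys ! 0) # map ?tl gs)))"
    by (rule Mu.IH) (use Mu.prems hd in \<open>auto intro: recf_tl\<close>)
  let ?tl2 = "\<lambda>h ys. h (tl (tl ys))"
  have tl: "recf A (Suc (Suc m)) (?tl2 h)" if "recf A m h" for h
    using recf_tl[OF recf_tl[OF that]] .
  have 2: "recf A (Suc (Suc m)) (\<lambda>ys. ev A (?tl2 a ys) (?tl2 b ys) f (map (\<lambda>g. g ys) ((\<lambda>ys. ys ! 0) # map ?tl2 gs)))"
    by (rule Mu.IH) (use Mu.prems hd in \<open>auto intro: tl\<close>)
  have 3: "decp A (Suc m) (\<lambda>ys. \<forall>j<ys ! 0. 1 < ev A (?tl a ys) (?tl b ys) f (j # map (\<lambda>g. g (tl ys)) gs))"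
    by (intro decp_ball decp_less recf_nth recf_const) (use 2 in \<open>simp_all add: comp_def\<close>)
  have 4: "decp A (Suc m) (\<lambda>ys. ev A (?tl a ys) (?tl b ys) f (ys ! 0 # map (\<lambda>g. g (tl ys)) gs) = 1)"
    by (intro decp_eq recf_const) (use 1 in \<open>simp add: comp_def\<close>)
  show ?case unfolding ev.simps
    by (intro recf_sum Mu.prems recf_mult recf_of_bool decp_conj 3 4 recf_Suc recf_nth) simp
qed

lemma recf_ev [rec_intros]:
  assumes "recf A m a" "recf A m b" "recf A m f"
  shows "recf A m (\<lambda>xs. ev A (a xs) (b xs) c [f xs])"
  using recf_ev_list[OF assms(1,2), of "[f]" c] assms(3) by simp

section \<open>Binary strings and blocks\<close>

lemma approximates_take_bit: "m \<le> n \<Longrightarrow> approximates \<sigma> n Z \<Longrightarrow> approximates (take_bit m \<sigma>) m Z"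
  by (auto simp: approximates_def bit_take_bit_iff)

lemma approximates_unique:
  assumes "\<sigma> < 2 ^ n" "\<tau> < 2 ^ n" "approximates \<sigma> n Z" "approximates \<tau> n Z"
  shows "\<sigma> = \<tau>"
proof -
  have "take_bit n \<sigma> = take_bit n \<tau>"
    using assms(3,4) by (auto simp: bit_eq_iff bit_take_bit_iff approximates_def)
  with assms(1,2) show ?thesis by (simp add: take_bit_nat_eq_self)
qed

lemma approximates_exists: "\<exists>\<sigma><2 ^ n. approximates \<sigma> n Z"
proof (intro exI conjI)
  let ?\<sigma> = "horner_sum of_bool 2 (map (\<lambda>i. i \<in> Z) [0..<n]) :: nat"
  show "?\<sigma> < 2 ^ n" using horner_sum_of_bool_2_less[of "map (\<lambda>i. i \<in> Z) [0..<n]", where 'a=nat] by simp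
  show "approximates ?\<sigma> n Z"
    by (auto simp: approximates_def bit_horner_sum_bit_iff)
qed

text \<open>A string of length \<open>n\<close> splits uniquely into its first \<open>m\<close> bits
  and an arbitrary rest, so the proportion of \<open>S\<close> is the same at every later
  level.\<close>

lemma card_extensions:
  assumes "S \<subseteq> {..<2 ^ m}" "m \<le> n"
  shows "card {\<sigma>. \<sigma> < 2 ^ n \<and> take_bit m \<sigma> \<in> S} = 2 ^ (n - m) * card (S :: nat set)"
proof -
  let ?E = "{\<sigma>. \<sigma> < 2 ^ n \<and> take_bit m \<sigma> \<in> S}"
  have n: "(2::nat) ^ n = 2 ^ m * 2 ^ (n - m)" using assms(2) by (simp flip: power_add)
  have "bij_betw (\<lambda>\<sigma>. (take_bit m \<sigma>, drop_bit m \<sigma>)) ?E (S \<times> {..<2 ^ (n - m)})"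
  proof (rule bij_betw_byWitness[where f'="\<lambda>(s, t). s + 2 ^ m * t"])
    show "\<forall>\<sigma>\<in>?E. (case (take_bit m \<sigma>, drop_bit m \<sigma>) of (s, t) \<Rightarrow> s + 2 ^ m * t) = \<sigma>"
      by (simp add: take_bit_eq_mod drop_bit_eq_div)
    show "\<forall>x\<in>S \<times> {..<2 ^ (n - m)}. (take_bit m (case x of (s, t) \<Rightarrow> s + 2 ^ m * t),
        drop_bit m (case x of (s, t) \<Rightarrow> s + 2 ^ m * t)) = x"
      using assms(1) by (auto simp: take_bit_eq_mod drop_bit_eq_div)
    show "(\<lambda>\<sigma>. (take_bit m \<sigma>, drop_bit m \<sigma>)) ` ?E \<subseteq> S \<times> {..<2 ^ (n - m)}"
      by (auto simp: drop_bit_eq_div n div_less_iff_less_mult mult.commute)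
    show "(\<lambda>(s, t). s + 2 ^ m * t) ` (S \<times> {..<2 ^ (n - m)}) \<subseteq> ?E"
    proof clarsimp
      fix s t :: nat assume st: "s \<in> S" "t < 2 ^ (n - m)"
      then have s: "s < 2 ^ m" using assms(1) by auto
      have "s + 2 ^ m * t < 2 ^ m * (t + 1)" using s by simp
      also have "\<dots> \<le> 2 ^ m * 2 ^ (n - m)" using st(2) by (intro mult_left_mono) auto
      finally show "s + 2 ^ m * t < 2 ^ n \<and> take_bit m (s + 2 ^ m * t) \<in> S"
        using s st(1) by (simp add: take_bit_eq_mod n)
    qed
  qed
  then have "card {\<sigma>. \<sigma> < 2 ^ n \<and> take_bit m \<sigma> \<in> S} = card (S \<times> {..<2 ^ (n - m) :: nat})"
    by (rule bij_betw_same_card)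
  then show ?thesis by (simp add: card_cartesian_product)
qed

section \<open>A Chebyshev bound for random strings\<close>

text \<open>The sign is such that a positive sum over \<open>x\<close> means more disagreements than
  agreements of \<open>w\<close> with \<open>y\<close>.\<close>

definition sgnbit :: "(nat \<Rightarrow> bool) \<Rightarrow> nat \<Rightarrow> nat \<Rightarrow> real" where
  "sgnbit w x y = (if w x = bit y x then -1 else 1)"

text \<open>Flipping bit \<open>x\<close> of \<open>y\<close> negates exactly one of the two
  factors, so the sum equals its own negative: different positions are uncorrelated.\<close>

lemma sum_sgnbit:
  assumes "x < M" "x \<noteq> x'"
  shows "(\<Sum>y<2 ^ M. sgnbit w x y * sgnbit w x' y) = 0"
proof -
  let ?s = "\<Sum>y<2 ^ M. sgnbit w x y * sgnbit w x' y"
  have lt: "flip_bit x y < 2 ^ M" if "y < 2 ^ M" for y :: nat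
  proof -
    have "take_bit M (flip_bit x y) = flip_bit x y"
      using that assms(1) by (simp add: take_bit_flip_bit_eq take_bit_nat_eq_self)
    then show ?thesis by (metis take_bit_nat_less_exp)
  qed
  have ff: "flip_bit x (flip_bit x y) = y" for y :: nat
    by (auto simp: bit_eq_iff bit_flip_bit_iff)
  have "?s = (\<Sum>y<2 ^ M. - (sgnbit w x y * sgnbit w x' y))"
    using lt ff assms(2)
    by (intro sum.reindex_bij_witness[where i="flip_bit x" and j="flip_bit x"])
      (auto simp: sgnbit_def bit_flip_bit_iff)
  then show ?thesis by (simp add: sum_negf)
qed

text \<open>Chebyshev's inequality: the sign sum \<open>s\<close> has mean square
  \<open>card I\<close> because the mixed terms cancel, and each counted \<open>y\<close> satisfies
  \<open>2 * card I \<le> r * s y\<close>.\<close>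

lemma card_far_le:
  assumes I: "I \<subseteq> {..<M}"
  shows "card {y::nat. y < 2 ^ M \<and> (r + 2) * card I < 2 * r * card {x \<in> I. w x \<noteq> bit y x}} * (4 * card I)
    \<le> r\<^sup>2 * 2 ^ M"
proof (cases "card I = 0")
  case False
  define F where "F = {y::nat. y < 2 ^ M \<and> (r + 2) * card I < 2 * r * card {x \<in> I. w x \<noteq> bit y x}}"
  have fin: "finite I" using False card_ge_0_finite by blast
  define s where "s y = (\<Sum>x\<in>I. sgnbit w x y)" for y :: nat
  have s_eq: "s y = 2 * card {x \<in> I. w x \<noteq> bit y x} - real (card I)" for y :: nat
  proof -
    have "s y = (\<Sum>x\<in>I. 2 * of_bool (w x \<noteq> bit y x) - 1)"
      unfolding s_def by (intro sum.cong) (auto simp: sgnbit_def)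
    then show ?thesis using fin
      by (simp add: sum_subtractf flip: sum_distrib_left) (simp add: of_bool_def sum.If_cases Int_def)
  qed
  have "(\<Sum>y<2 ^ M. (s y)\<^sup>2) = (\<Sum>y<2 ^ M. \<Sum>x\<in>I. \<Sum>x'\<in>I. sgnbit w x y * sgnbit w x' y)"
    by (simp add: s_def power2_eq_square sum_product)
  also have "\<dots> = (\<Sum>x\<in>I. \<Sum>x'\<in>I. \<Sum>y<2 ^ M. sgnbit w x y * sgnbit w x' y)"
    by (subst sum.swap, rule sum.cong[OF refl], subst sum.swap, rule refl)
  also have "\<dots> = (\<Sum>x\<in>I. \<Sum>x'\<in>I. if x' = x then 2 ^ M else 0)"
  proof (intro sum.cong refl)
    fix x x' assume "x \<in> I" "x' \<in> I"
    then show "(\<Sum>y<2 ^ M. sgnbit w x y * sgnbit w x' y) = (if x' = x then 2 ^ M else 0)"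
      using sum_sgnbit[of x M x' w] I by (auto simp: sgnbit_def if_distrib cong: if_cong)
  qed
  also have "\<dots> = card I * 2 ^ M" using fin by simp
  finally have total: "(\<Sum>y<2 ^ M. (s y)\<^sup>2) = card I * 2 ^ M" .
  have far: "(2 * real (card I))\<^sup>2 \<le> (real r)\<^sup>2 * (s y)\<^sup>2" if "y \<in> F" for y
  proof -
    have "real ((r + 2) * card I) < real (2 * r * card {x \<in> I. w x \<noteq> bit y x})"
      using that unfolding F_def by (subst of_nat_less_iff) simp
    then have "2 * real (card I) \<le> r * s y" by (simp add: s_eq algebra_simps)
    then show ?thesis unfolding power_mult_distrib[symmetric] by (intro power_mono) auto
  qed
  have "real (card F) * (2 * real (card I))\<^sup>2 \<le> (\<Sum>y\<in>F. (real r)\<^sup>2 * (s y)\<^sup>2)"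
    using sum_mono[of F "\<lambda>_. (2 * real (card I))\<^sup>2", OF far] by simp
  also have "\<dots> \<le> (\<Sum>y<2 ^ M. (real r)\<^sup>2 * (s y)\<^sup>2)"
    by (rule sum_mono2) (auto simp: F_def)
  also have "\<dots> = (real r)\<^sup>2 * (card I * 2 ^ M)" using total by (simp flip: sum_distrib_left)
  finally have "(real (card F) * (4 * card I)) * card I \<le> ((real r)\<^sup>2 * 2 ^ M) * card I"
    by (simp add: power2_eq_square algebra_simps)
  then have "real (card F) * (4 * card I) \<le> (real r)\<^sup>2 * 2 ^ M"
    using False by (subst (asm) mult_le_cancel_right_pos) auto
  then have "real (card F * (4 * card I)) \<le> real (r\<^sup>2 * 2 ^ M)" by simp
  then show ?thesis unfolding F_def by (subst (asm) of_nat_le_iff)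
qed simp

text \<open>
  Blocks are long enough for the Chebyshev bounds, even after multiplication by \<open>(k + 1)^2\<close>, to be
  summable, and short enough that a single block is negligible against its predecessors.
\<close>

definition block :: "nat \<Rightarrow> nat set" where
  "block k = {k ^ 5..<(k + 1) ^ 5}"

lemma card_block_ge: "(k + 1) ^ 4 \<le> card (block k)"
proof -
  have "(k + 1) ^ 4 + k * k ^ 4 \<le> (k + 1) ^ 4 + k * (k + 1) ^ 4"
    by (intro add_left_mono mult_left_mono power_mono) auto
  then show ?thesis by (simp add: block_def eval_nat_numeral algebra_simps)
qed

text \<open>
  The density of \<open>P\<close> on the block exceeds \<open>1/2 + 1/r\<close>, multiplied out so that it is a
  decidable statement about natural numbers.
\<close>

definition far :: "nat \<Rightarrow> nat \<Rightarrow> (nat \<Rightarrow> bool) \<Rightarrow> bool" where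
  "far r k P \<longleftrightarrow> (r + 2) * card (block k) < 2 * r * card {x \<in> block k. P x}"

lemma far_mono:
  assumes "far r k P" and "\<And>x. x \<in> block k \<Longrightarrow> P x \<Longrightarrow> Q x" shows "far r k Q"
proof -
  have "card {x \<in> block k. P x} \<le> card {x \<in> block k. Q x}"
    using assms(2) by (intro card_mono) (auto simp: block_def)
  then show ?thesis using assms(1) unfolding far_def
    by (meson le_less_trans less_le_trans mult_le_mono2)
qed

lemma decp_far [rec_intros]:
  assumes k: "recf A m k" and P: "decp A (Suc m) (\<lambda>ys. P (ys ! 0) (tl ys))"
  shows "decp A m (\<lambda>xs. far r (k xs) (\<lambda>x. P x xs))"
proof -
  have "{x \<in> block j. Q x} = {x. x < (j + 1) ^ 5 \<and> j ^ 5 \<le> x \<and> Q x}" for j Q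
    by (auto simp: block_def)
  then show ?thesis unfolding far_def
    by (simp only:) (simp only: block_def card_atLeastLessThan,
      intro rec_intros k recf_tl[OF k] P, simp_all)
qed

lemma card_far_block_le:
  assumes "(k + 1) ^ 5 \<le> M"
  shows "card {y::nat. y < 2 ^ M \<and> far r k (\<lambda>x. w x \<noteq> bit y x)} * (4 * (k + 1) ^ 4) \<le> r\<^sup>2 * 2 ^ M"
    (is "card ?F * _ \<le> _")
proof -
  have "card ?F * (4 * (k + 1) ^ 4) \<le> card ?F * (4 * card (block k))"
    using card_block_ge[of k] by (intro mult_left_mono) auto
  also have "\<dots> \<le> r\<^sup>2 * 2 ^ M"
    unfolding far_def by (rule card_far_le) (use assms in \<open>auto simp: block_def\<close>)
  finally show ?thesis .
qed

section \<open>From densities on blocks to upper density\<close>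

definition block_index :: "nat \<Rightarrow> nat" where
  "block_index x = (LEAST k. x < (k + 1) ^ 5)"

lemma block_index_exists: "\<exists>k. x < (k + 1) ^ 5" for x :: nat
  by (rule exI[of _ x]) (use self_le_power[of "x + 1" 5] in simp)

lemma mem_block_index: "x \<in> block (block_index x)"
proof -
  have 1: "x < (block_index x + 1) ^ 5"
    unfolding block_index_def by (rule LeastI_ex[OF block_index_exists])
  have "block_index x ^ 5 \<le> x"
  proof (cases "block_index x")
    case (Suc k)
    then have "\<not> x < (k + 1) ^ 5"
      by (intro not_less_Least) (simp add: block_index_def)
    then show ?thesis using Suc by simp
  qed simp
  with 1 show ?thesis by (simp add: block_def)
qed

lemma block_index_eq: "x \<in> block k \<Longrightarrow> block_index x = k"
proof -
  assume k: "x \<in> block k"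
  have *: "i \<le> j" if "x \<in> block i" "x \<in> block j" for i j
  proof (rule ccontr)
    assume "\<not> i \<le> j"
    then have "(j + 1) ^ 5 \<le> i ^ 5" by (intro power_mono) auto
    with that show False unfolding block_def by (simp only: atLeastLessThan_iff) linarith
  qed
  show ?thesis using *[OF k mem_block_index] *[OF mem_block_index k] by simp
qed

text \<open>Adding up the blocks bounds the counts at block ends. Between two ends the unfinished
  block is negligible, since consecutive fifth powers have ratio tending to 1.\<close>

lemma upper_density_le_of_blocks:
  assumes r: "0 < r" and D: "\<And>k. N \<le> k \<Longrightarrow> \<not> far r k (\<lambda>x. x \<in> D)"
  shows "upper_density D \<le> 1 / 2 + 1 / real r"
proof -
  define c where "c = 1 / 2 + 1 / real r"
  have c: "0 \<le> c" by (simp add: c_def)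
  have D': "real (card (D \<inter> block k)) \<le> c * card (block k)" if "N \<le> k" for k
  proof -
    have "real (2 * r * card (D \<inter> block k)) \<le> real ((r + 2) * card (block k))"
      using D[OF that] by (subst of_nat_le_iff) (simp add: far_def Int_def conj_commute)
    then show ?thesis using r by (simp add: c_def field_simps)
  qed
  \<comment> \<open>The summand \<open>N ^ 5\<close> pays for the first \<open>N\<close> blocks, on
    which nothing is assumed.\<close>
  have le: "real (card (D \<inter> {0..<k ^ 5})) \<le> N ^ 5 + c * k ^ 5" for k
  proof (induction k)
    case (Suc k)
    show ?case
    proof (cases "N \<le> k")
      case True
      have mono: "k ^ 5 \<le> Suc k ^ 5" by (rule power_mono) auto
      have "D \<inter> {0..<Suc k ^ 5} = (D \<inter> {0..<k ^ 5}) \<union> (D \<inter> block k)"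
        using order.strict_trans2[OF _ mono] by (auto simp: block_def)
      then have "card (D \<inter> {0..<Suc k ^ 5}) \<le> card (D \<inter> {0..<k ^ 5}) + card (D \<inter> block k)"
        by (simp only: card_Un_le)
      then have "real (card (D \<inter> {0..<Suc k ^ 5})) \<le> card (D \<inter> {0..<k ^ 5}) + card (D \<inter> block k)"
        by linarith
      also have "\<dots> \<le> N ^ 5 + c * k ^ 5 + c * (real (Suc k ^ 5) - k ^ 5)"
        using Suc D'[OF True] mono by (simp add: block_def of_nat_diff flip: of_nat_power)
      finally show ?thesis by (simp add: algebra_simps)
    next
      case False
      have "card (D \<inter> {0..<Suc k ^ 5}) \<le> card {0..<Suc k ^ 5}" by (rule card_mono) auto
      also have "\<dots> \<le> N ^ 5" using False power_mono[of "Suc k" N 5] by simp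
      finally have "real (card (D \<inter> {0..<Suc k ^ 5})) \<le> N ^ 5" by (metis of_nat_le_iff)
      also have "\<dots> \<le> N ^ 5 + c * Suc k ^ 5" using c by simp
      finally show ?thesis by simp
    qed
  qed simp
  define g where "g k = (real N / k) ^ 5 + c * (1 + 1 / k) ^ 5" for k :: nat
  have "g \<longlonglongrightarrow> 0 ^ 5 + c * (1 + 0) ^ 5"
    unfolding g_def by (intro tendsto_intros lim_const_over_n)
  then have g: "g \<longlonglongrightarrow> c" by simp
  have pd: "partial_density n D \<le> g (block_index n)" if "1 \<le> n" for n
  proof -
    let ?k = "block_index n"
    have k: "?k ^ 5 \<le> n" "n < (?k + 1) ^ 5" using mem_block_index[of n] by (auto simp: block_def)
    have kpos: "0 < ?k" using k(2) that by (cases "?k") auto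
    \<comment> \<open>The block containing \<open>n\<close> is counted in full, while the
      denominator is later lowered to its left end.\<close>
    have "card (D \<inter> {0..<n}) \<le> card (D \<inter> {0..<(?k + 1) ^ 5})"
      using k(2) by (intro card_mono) auto
    then have "real (card (D \<inter> {0..<n})) \<le> real (card (D \<inter> {0..<(?k + 1) ^ 5}))"
      by (subst of_nat_le_iff)
    also have "\<dots> \<le> N ^ 5 + c * real (?k + 1) ^ 5" using le[of "?k + 1"] by simp
    finally have "partial_density n D \<le> (N ^ 5 + c * real (?k + 1) ^ 5) / n"
      unfolding partial_density_def by (intro divide_right_mono) auto
    also have "\<dots> \<le> (N ^ 5 + c * real (?k + 1) ^ 5) / real (?k ^ 5)"
      using k(1) kpos c that by (intro divide_left_mono) (auto simp del: of_nat_power)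
    also have "\<dots> = g ?k"
      using kpos by (simp add: g_def field_simps power_divide)
    finally show ?thesis .
  qed
  have "upper_density D \<le> c + e" if e: "0 < e" for e
  proof -
    obtain K where K: "\<And>k. K \<le> k \<Longrightarrow> g k \<le> c + e"
      using order_tendstoD(2)[OF g, of "c + e"] e
      unfolding eventually_sequentially by (meson less_add_same_cancel1 less_imp_le)
    have "partial_density n D \<le> c + e" if "K ^ 5 + 1 \<le> n" for n
    proof -
      have "K \<le> block_index n"
      proof (rule ccontr)
        assume "\<not> K \<le> block_index n"
        then have "(block_index n + 1) ^ 5 \<le> K ^ 5" by (intro power_mono) auto
        with mem_block_index[of n] that show False
          unfolding block_def by (simp only: atLeastLessThan_iff) linarith
      qed
      from K[OF this] pd[of n] that show ?thesis by simp
    qed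
    then have "limsup (\<lambda>n. ereal (partial_density n D)) \<le> ereal (c + e)"
      by (intro Limsup_bounded eventually_sequentiallyI[of "K ^ 5 + 1"]) simp
    then show ?thesis by (simp flip: ereal_upper_density)
  qed
  then show ?thesis unfolding c_def by (rule field_le_epsilon)
qed

section \<open>Trees of positive density\<close>

text \<open>A node of level \<open>n\<close> is a number below \<open>2 ^ n\<close> whose bit
  \<open>i\<close> is the digit at depth \<open>i\<close>, so \<open>take_bit\<close> passes to an
  initial segment.\<close>

definition btree :: "(nat \<Rightarrow> nat set) \<Rightarrow> bool" where
  "btree T \<longleftrightarrow> (\<forall>n. T n \<subseteq> {..<2 ^ n}) \<and> (\<forall>m n. \<forall>\<sigma>\<in>T n. m \<le> n \<longrightarrow> take_bit m \<sigma> \<in> T m)"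

text \<open>For a \<open>btree\<close> the proportions of nodes decrease to the measure of its set
  of branches, so this says that the measure is positive.\<close>

definition fat :: "(nat \<Rightarrow> nat set) \<Rightarrow> bool" where
  "fat T \<longleftrightarrow> (\<exists>\<delta>>0. \<forall>n. \<delta> * 2 ^ n \<le> real (card (T n)))"

definition branch :: "(nat \<Rightarrow> nat set) \<Rightarrow> nat set \<Rightarrow> bool" where
  "branch T Z \<longleftrightarrow> (\<forall>n. \<exists>\<sigma>\<in>T n. approximates \<sigma> n Z)"

lemma btree_less: "btree T \<Longrightarrow> \<sigma> \<in> T n \<Longrightarrow> \<sigma> < 2 ^ n"
  by (auto simp: btree_def)

lemma btree_take_bit: "btree T \<Longrightarrow> \<sigma> \<in> T n \<Longrightarrow> m \<le> n \<Longrightarrow> take_bit m \<sigma> \<in> T m"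
  by (auto simp: btree_def)

lemma btree_finite: "btree T \<Longrightarrow> finite (T n)"
  by (auto simp: btree_def intro: finite_subset)

lemma fat_nonempty: "fat T \<Longrightarrow> T n \<noteq> {}"
proof
  assume "fat T" "T n = {}"
  then obtain \<delta> :: real where "\<delta> > 0" "\<delta> * 2 ^ n \<le> 0" by (auto simp: fat_def dest: spec[of _ n])
  then show False using mult_pos_pos[OF \<open>\<delta> > 0\<close> zero_less_power[of 2 n]] by linarith
qed

lemma full_tree: "btree (\<lambda>n. {..<2 ^ n})" "fat (\<lambda>n. {..<2 ^ n})"
proof -
  show "btree (\<lambda>n. {..<2 ^ n})" by (auto simp: btree_def)
  show "fat (\<lambda>n. {..<2 ^ n})" unfolding fat_def by (intro exI[of _ 1]) auto
qed

text \<open>Compactness of Cantor space. The branch is grown inside \<open>S\<close>, the nodes that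
  have extensions at all higher levels of every tree.\<close>

lemma branch_fusion:
  fixes T :: "nat \<Rightarrow> nat \<Rightarrow> nat set"
  assumes tree: "\<And>j. btree (T j)" and ne: "\<And>j n. T j n \<noteq> {}"
    and dec: "\<And>i j n. i \<le> j \<Longrightarrow> T j n \<subseteq> T i n"
  shows "\<exists>Z. \<forall>j. branch (T j) Z"
proof -
  define S where "S n = {\<sigma>. \<sigma> < 2 ^ n \<and> (\<forall>j m. n \<le> m \<longrightarrow> (\<exists>\<tau>\<in>T j m. take_bit n \<tau> = \<sigma>))}" for n
  have "0 \<in> S 0" using ne by (auto simp: S_def)
  have step: "\<exists>\<tau>\<in>S (Suc n). take_bit n \<tau> = \<sigma>" if \<sigma>: "\<sigma> \<in> S n" for \<sigma> n
  proof (rule ccontr)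
    assume no: "\<not> ?thesis"
    define E where "E = {\<tau>. \<tau> < 2 ^ Suc n \<and> take_bit n \<tau> = \<sigma>}"
    have "finite E" by (simp add: E_def)
    \<comment> \<open>If neither child of \<sigma> were in \<open>S\<close>, each would be cut off
      in some tree at some level. A tree late enough and a level high enough, obtained by summing
      the two indices, would cut off both.\<close>
    have "\<forall>\<tau>\<in>E. \<exists>jm. Suc n \<le> snd jm \<and> (\<forall>\<rho>\<in>T (fst jm) (snd jm). take_bit (Suc n) \<rho> \<noteq> \<tau>)"
      using no by (force simp: S_def E_def)
    then obtain jm where jm: "\<And>\<tau>. \<tau> \<in> E \<Longrightarrow> Suc n \<le> snd (jm \<tau>)"
      "\<And>\<tau> \<rho>. \<tau> \<in> E \<Longrightarrow> \<rho> \<in> T (fst (jm \<tau>)) (snd (jm \<tau>)) \<Longrightarrow> take_bit (Suc n) \<rho> \<noteq> \<tau>"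
      by metis
    define j where "j = (\<Sum>\<tau>\<in>E. fst (jm \<tau>))"
    define m where "m = n + 1 + (\<Sum>\<tau>\<in>E. snd (jm \<tau>))"
    have "n \<le> m" by (simp add: m_def)
    then obtain \<rho> where \<rho>: "\<rho> \<in> T j m" "take_bit n \<rho> = \<sigma>" using \<sigma> unfolding S_def by blast
    define \<tau> where "\<tau> = take_bit (Suc n) \<rho>"
    have \<tau>: "\<tau> \<in> E" using \<rho>(2) take_bit_nat_less_exp[of "Suc n" \<rho>] by (simp add: E_def \<tau>_def)
    have "fst (jm \<tau>) \<le> j" "snd (jm \<tau>) \<le> m"
      using member_le_sum[OF \<tau>, of "\<lambda>\<tau>. fst (jm \<tau>)"] member_le_sum[OF \<tau>, of "\<lambda>\<tau>. snd (jm \<tau>)"]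
        \<open>finite E\<close> by (auto simp: j_def m_def)
    then have "take_bit (snd (jm \<tau>)) \<rho> \<in> T (fst (jm \<tau>)) (snd (jm \<tau>))"
      using btree_take_bit[OF tree \<rho>(1)] dec by blast
    from jm(2)[OF \<tau> this] jm(1)[OF \<tau>] show False by (simp add: \<tau>_def min_def)
  qed
  have "\<exists>f. \<forall>n. f n \<in> S n \<and> take_bit n (f (Suc n)) = f n"
    by (rule dependent_nat_choice) (use \<open>0 \<in> S 0\<close> step in blast)+
  then obtain f where f: "\<And>n. f n \<in> S n" "\<And>n. take_bit n (f (Suc n)) = f n" by blast
  have "take_bit n (f (n + k)) = f n" for n k
  proof (induction k)
    case 0
    show ?case using f(1)[of n] by (simp add: S_def take_bit_nat_eq_self)
  next
    case (Suc k)
    have "take_bit n (f (n + Suc k)) = take_bit n (take_bit (n + k) (f (Suc (n + k))))"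
      by (simp add: min_def)
    then show ?case using Suc by (simp add: f(2))
  qed
  then have f': "take_bit m (f n) = f m" if "m \<le> n" for m n
    using that by (metis le_add_diff_inverse)
  have "approximates (f n) n {i. bit (f (Suc i)) i}" for n
    unfolding approximates_def
  proof clarsimp
    fix i assume "i < n"
    then have "take_bit (Suc i) (f n) = f (Suc i)" by (intro f') simp
    then show "bit (f n) i = bit (f (Suc i)) i"
      by (metis bit_take_bit_iff lessI)
  qed
  moreover have "f n \<in> T j n" for j n
  proof -
    obtain \<tau> where \<tau>: "\<tau> \<in> T j n" "take_bit n \<tau> = f n" using f(1)[of n] unfolding S_def by blast
    then show ?thesis using btree_less[OF tree \<tau>(1)] by (simp add: take_bit_nat_eq_self)
  qed
  ultimately show ?thesis unfolding branch_def by blast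
qed

text \<open>Requirements are met one after another along an enumeration of the index type. The class
  \<open>C\<close> of conditions is a parameter: it is used with the trees decidable from
  \<open>A\<close> and again with all fat trees.\<close>

lemma generic_branch:
  fixes R :: "'i::countable \<Rightarrow> nat set \<Rightarrow> bool"
  assumes "C T0" and C: "\<And>T. C T \<Longrightarrow> btree T \<and> fat T"
    and R: "\<And>T i. C T \<Longrightarrow> \<exists>T'. C T' \<and> (\<forall>n. T' n \<subseteq> T n) \<and> (\<forall>Z. branch T' Z \<longrightarrow> R i Z)"
  shows "\<exists>Z. \<forall>i. R i Z"
proof -
  have "\<exists>T. \<forall>j. C (T j) \<and> ((\<forall>n. T (Suc j) n \<subseteq> T j n) \<and> (\<forall>Z. branch (T (Suc j)) Z \<longrightarrow> R (from_nat j) Z))"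
    by (rule dependent_nat_choice) (use assms(1) R in blast)+
  then obtain T where T: "\<And>j. C (T j)" "\<And>j n. T (Suc j) n \<subseteq> T j n"
    "\<And>j Z. branch (T (Suc j)) Z \<Longrightarrow> R (from_nat j) Z" by blast
  have "T j n \<subseteq> T i n" if "i \<le> j" for i j n
    using that by (rule lift_Suc_antimono_le[of "\<lambda>j. T j n", rotated]) (rule T(2))
  then obtain Z where Z: "\<And>j. branch (T j) Z"
    using branch_fusion[of T] C[OF T(1)] fat_nonempty by meson
  have "R i Z" for i using T(3)[OF Z, of "to_nat i"] by simp
  then show ?thesis by blast
qed

section \<open>Pruning a tree by a summable test\<close>

text \<open>The bound \<open>k < m\<close> leaves finitely many conditions at each level, which
  keeps the tree decidable; each \<open>k\<close> becomes active at level
  \<open>k + 1\<close>.\<close>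

definition thin :: "(nat \<Rightarrow> nat set) \<Rightarrow> (nat \<Rightarrow> nat \<Rightarrow> nat set) \<Rightarrow> nat \<Rightarrow> nat \<Rightarrow> nat set" where
  "thin T V N m = {\<sigma> \<in> T m. \<forall>k<m. N \<le> k \<longrightarrow> \<sigma> \<notin> V k m}"

text \<open>The nodes \<open>V k m\<close> describe, level by level, an open set of measure at most
  \<open>K / (k + 1)^2\<close>. These measures are summable, as in the Borel-Cantelli lemma.\<close>

locale small_test =
  fixes V :: "nat \<Rightarrow> nat \<Rightarrow> nat set" and K :: real
  assumes V_less: "V k m \<subseteq> {..<2 ^ m}"
    and V_mono: "\<sigma> < 2 ^ n \<Longrightarrow> m \<le> n \<Longrightarrow> take_bit m \<sigma> \<in> V k m \<Longrightarrow> \<sigma> \<in> V k n"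
    and V_card: "real (card (V k m)) * (real k + 1)\<^sup>2 \<le> K * 2 ^ m"
begin

lemma btree_thin: "btree T \<Longrightarrow> btree (thin T V N)"
proof -
  assume T: "btree T"
  show "btree (thin T V N)"
    unfolding btree_def
  proof (intro conjI allI ballI impI)
    show "thin T V N n \<subseteq> {..<2 ^ n}" for n using btree_less[OF T] by (auto simp: thin_def)
    fix m n \<sigma> assume "\<sigma> \<in> thin T V N n" "m \<le> n"
    moreover have "\<sigma> \<notin> V k n \<Longrightarrow> take_bit m \<sigma> \<notin> V k m" if "\<sigma> \<in> T n" "m \<le> n" for k
      using V_mono[OF btree_less[OF T that(1)] that(2)] by blast
    ultimately show "take_bit m \<sigma> \<in> thin T V N m"
      using btree_take_bit[OF T] by (auto simp: thin_def)
  qed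
qed

lemma branch_thin:
  assumes T: "btree T" and "branch (thin T V N) Z" "N \<le> k" "\<sigma> \<in> V k m"
  shows "\<not> approximates \<sigma> m Z"
proof
  assume \<sigma>: "approximates \<sigma> m Z"
  \<comment> \<open>At this level a node extends \<sigma> and the index \<open>k\<close> is already
    active in \<open>thin\<close>.\<close>
  let ?n = "max m (Suc k)"
  obtain \<tau> where \<tau>: "\<tau> \<in> thin T V N ?n" "approximates \<tau> ?n Z"
    using assms(2) by (auto simp: branch_def)
  have "take_bit m \<tau> = \<sigma>"
  proof (rule approximates_unique[OF _ _ approximates_take_bit[OF _ \<tau>(2)] \<sigma>])
    show "\<sigma> < 2 ^ m" using assms(4) V_less by auto
  qed (auto intro: take_bit_nat_less_exp)
  with V_mono[of \<tau> ?n m k] assms(4) \<tau>(1) btree_less[OF T, of \<tau> ?n]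
  have "\<tau> \<in> V k ?n" by (simp add: thin_def)
  with \<tau>(1) assms(3) show False by (auto simp: thin_def)
qed

text \<open>Union bound: pruning from index \<open>N\<close> on removes at most the proportion
  \<open>|K| / N\<close> of all nodes of a level, and \<open>N\<close> is chosen to make this at
  most half of the density \<delta>.\<close>

lemma fat_thin:
  assumes T: "btree T" "fat T"
  shows "\<exists>N. fat (thin T V N)"
proof -
  obtain \<delta> where \<delta>: "\<delta> > 0" "\<And>n. \<delta> * 2 ^ n \<le> real (card (T n))"
    using T(2) by (auto simp: fat_def)
  obtain N where N: "2 * \<bar>K\<bar> / \<delta> + 1 \<le> real N" using real_arch_simple by blast
  have Npos: "1 \<le> real N" using N \<delta>(1) by (smt (verit) divide_nonneg_pos)
  have KN: "\<bar>K\<bar> / N \<le> \<delta> / 2" using N Npos \<delta>(1) by (simp add: field_simps)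
  \<comment> \<open>Telescoping, as \<open>1 / (k + 1)^2 \<le> 1 / k - 1 / (k + 1)\<close>.\<close>
  have tail: "(\<Sum>k\<in>{N..<m}. 1 / (real k + 1)\<^sup>2) \<le> 1 / N - 1 / m" if "N \<le> m" for m
    using that
  proof (induction m rule: dec_induct)
    case (step m)
    have "0 < real m" using step.hyps Npos by linarith
    then have "1 / m - 1 / (real m + 1) = 1 / (m * (real m + 1))"
      by (simp add: field_simps)
    moreover have "1 / (real m + 1)\<^sup>2 \<le> 1 / (m * (real m + 1))"
      using \<open>0 < real m\<close> unfolding power2_eq_square
      by (intro divide_left_mono mult_right_mono mult_pos_pos) auto
    ultimately have "1 / (real m + 1)\<^sup>2 \<le> 1 / m - 1 / (real m + 1)" by simp
    with step show ?case by (simp add: add.commute)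
  qed simp
  have "\<delta> / 2 * 2 ^ m \<le> real (card (thin T V N m))" for m
  proof -
    have fin: "finite (V k m)" for k using V_less finite_subset by blast
    have "T m \<subseteq> thin T V N m \<union> (\<Union>k\<in>{N..<m}. V k m)" by (auto simp: thin_def)
    then have "card (T m) \<le> card (thin T V N m \<union> (\<Union>k\<in>{N..<m}. V k m))"
      using btree_finite[OF btree_thin[OF T(1)]] fin by (intro card_mono) auto
    also have "\<dots> \<le> card (thin T V N m) + (\<Sum>k\<in>{N..<m}. card (V k m))"
      by (intro order_trans[OF card_Un_le] add_left_mono card_UN_le) simp
    finally have "real (card (T m)) \<le> card (thin T V N m) + (\<Sum>k\<in>{N..<m}. real (card (V k m)))"
      by (simp flip: of_nat_sum of_nat_add)
    also have "(\<Sum>k\<in>{N..<m}. real (card (V k m))) \<le> (\<Sum>k\<in>{N..<m}. \<bar>K\<bar> * 2 ^ m * (1 / (real k + 1)\<^sup>2))"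
    proof (rule sum_mono)
      fix k
      have "real (card (V k m)) * (real k + 1)\<^sup>2 \<le> \<bar>K\<bar> * 2 ^ m"
        using V_card[of k m] by (smt (verit) mult_right_mono zero_le_power)
      then show "real (card (V k m)) \<le> \<bar>K\<bar> * 2 ^ m * (1 / (real k + 1)\<^sup>2)"
        by (simp add: field_simps)
    qed
    also have "\<dots> = \<bar>K\<bar> * 2 ^ m * (\<Sum>k\<in>{N..<m}. 1 / (real k + 1)\<^sup>2)"
      by (rule sum_distrib_left[symmetric])
    also have "\<dots> \<le> \<bar>K\<bar> * 2 ^ m * (1 / N)"
    proof (rule mult_left_mono)
      show "(\<Sum>k\<in>{N..<m}. 1 / (real k + 1)\<^sup>2) \<le> 1 / N"
      proof (cases "N \<le> m")
        case True
        have "0 \<le> 1 / real m" by simp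
        with tail[OF True] show ?thesis by linarith
      qed simp
    qed simp
    also have "\<dots> \<le> \<delta> / 2 * 2 ^ m"
      using mult_right_mono[OF KN, of "2 ^ m"] by (simp add: mult.commute)
    finally show ?thesis using \<delta>(2)[of m] by simp
  qed
  with \<delta>(1) show ?thesis unfolding fat_def by (intro exI[of _ N] exI[of _ "\<delta> / 2"]) auto
qed

end

section \<open>Evading the predictions of a random oracle\<close>

lemma decp_compose2:
  "decp A 2 (\<lambda>ys. P (ys ! 0) (ys ! 1)) \<Longrightarrow> recf A m g \<Longrightarrow> recf A m h
    \<Longrightarrow> decp A m (\<lambda>xs. P (g xs) (h xs))"
  unfolding decp_def by (rule recf_compose2)

lemma decp_compose3:
  "decp A 3 (\<lambda>ys. P (ys ! 0) (ys ! 1) (ys ! 2)) \<Longrightarrow> recf A m g \<Longrightarrow> recf A m h \<Longrightarrow> recf A m k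
    \<Longrightarrow> decp A m (\<lambda>xs. P (g xs) (h xs) (k xs))"
  unfolding decp_def by (rule recf_compose3)

text \<open>The forcing conditions. Decidability from \<open>A\<close> is what turns the search for
  an approximating set into a computation from \<open>A\<close>.\<close>

definition good_tree :: "nat set \<Rightarrow> (nat \<Rightarrow> nat set) \<Rightarrow> bool" where
  "good_tree A T \<longleftrightarrow> btree T \<and> fat T \<and> decp A 2 (\<lambda>xs. xs ! 1 \<in> T (xs ! 0))"

lemma good_tree_thin:
  assumes "good_tree A T" "small_test V K" "decp A 3 (\<lambda>xs. xs ! 2 \<in> V (xs ! 0) (xs ! 1))"
  obtains N where "good_tree A (thin T V N)"
proof -
  interpret small_test V K by fact
  have T: "btree T" "fat T" "decp A 2 (\<lambda>xs. xs ! 1 \<in> T (xs ! 0))"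
    using assms(1) by (auto simp: good_tree_def)
  obtain N where "fat (thin T V N)" using fat_thin[OF T(1,2)] by blast
  moreover have "decp A 2 (\<lambda>xs. xs ! 1 \<in> thin T V N (xs ! 0))"
    unfolding thin_def mem_Collect_eq
    by (intro rec_intros T(3) decp_compose3[OF assms(3)]) simp_all
  ultimately show ?thesis
    using that btree_thin[OF T(1)] by (auto simp: good_tree_def)
qed

lemma branch_mono: "branch T' Z \<Longrightarrow> (\<And>n. T' n \<subseteq> T n) \<Longrightarrow> branch T Z"
  unfolding branch_def by blast

lemma sum_card_swap:
  "(\<Sum>s<a. card {t. t < b \<and> Q s t}) = (\<Sum>t<b. card {s. s < a \<and> Q s t})" for a b :: nat
  unfolding card_less_eq_sum by (rule sum.swap)

text \<open>The proportion of nodes never grows with the level, so a tree that is sparse at one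
  level stays sparse.\<close>

lemma card_btree_le:
  assumes "btree T" "m \<le> n" shows "card (T n) \<le> 2 ^ (n - m) * card (T m)"
proof -
  have "card (T n) \<le> card {\<sigma>. \<sigma> < 2 ^ n \<and> take_bit m \<sigma> \<in> T m}"
    using btree_less[OF assms(1)] btree_take_bit[OF assms(1) _ assms(2)] by (intro card_mono) auto
  also have "\<dots> = 2 ^ (n - m) * card (T m)"
    using assms by (intro card_extensions) (auto simp: btree_def)
  finally show ?thesis .
qed

text \<open>Only definite wrong answers count, not missing ones; therefore membership persists under
  extension of \<beta>.\<close>

definition wrong :: "nat set \<Rightarrow> ocode \<Rightarrow> nat \<Rightarrow> nat \<Rightarrow> nat \<Rightarrow> (nat \<Rightarrow> bool) \<Rightarrow> nat set" where
  "wrong A c r k m P = {\<beta>. \<beta> < 2 ^ m \<and> far r k (\<lambda>x. ev A \<beta> m c [x] = Suc (of_bool (\<not> P x)))}"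

text \<open>
  For \<open>\<beta>\<close> chosen at random, the probability that the set computed by \<open>c\<close> from \<open>A\<close> and \<open>\<beta>\<close> is found to
  agree too little with \<open>Z\<close> on block \<open>k\<close> is summable over \<open>k\<close>.
\<close>

definition evades :: "nat set \<Rightarrow> ocode \<Rightarrow> nat \<Rightarrow> nat set \<Rightarrow> bool" where
  "evades A c r Z \<longleftrightarrow> (\<exists>N. \<forall>k\<ge>N. \<forall>m\<ge>(k + 1) ^ 5.
     card (wrong A c r k m (\<lambda>x. x \<in> Z)) * (k + 1)\<^sup>2 \<le> r\<^sup>2 * 2 ^ m)"

lemma wrong_cong: "(\<And>x. x \<in> block k \<Longrightarrow> P x = Q x) \<Longrightarrow> wrong A c r k m P = wrong A c r k m Q"
  unfolding wrong_def by (auto elim: far_mono)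

lemma wrong_mono:
  assumes "\<beta> < 2 ^ n" "m \<le> n" "take_bit m \<beta> \<in> wrong A c r k m P"
  shows "\<beta> \<in> wrong A c r k n P"
proof -
  have "far r k (\<lambda>x. ev A (take_bit m \<beta>) m c [x] = Suc (of_bool (\<not> P x)))"
    using assms(3) by (simp add: wrong_def)
  then have "far r k (\<lambda>x. ev A \<beta> n c [x] = Suc (of_bool (\<not> P x)))"
    by (rule far_mono) (rule ev_mono[OF assms(2)], auto simp: bit_take_bit_iff)
  with assms(1) show ?thesis by (simp add: wrong_def)
qed

text \<open>These are the nodes whose branches would violate the bound in \<open>evades\<close> at
  \<open>k\<close>. The condition \<open>(k + 1) ^ 5 \<le> m\<close> ensures that \<sigma> settles
  block \<open>k\<close>.\<close>

definition wrong_test :: "nat set \<Rightarrow> ocode \<Rightarrow> nat \<Rightarrow> nat \<Rightarrow> nat \<Rightarrow> nat set" where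
  "wrong_test A c r k m = {\<sigma>. \<sigma> < 2 ^ m \<and> (k + 1) ^ 5 \<le> m \<and>
     r\<^sup>2 * 2 ^ m < card (wrong A c r k m (bit \<sigma>)) * (k + 1)\<^sup>2}"

text \<open>Count the pairs \<open>(\<sigma>, \<beta>)\<close> in both orders: for fixed \<open>\<beta>\<close> few \<open>\<sigma>\<close> are far, then apply Markov.\<close>

lemma card_wrong_test:
  assumes r: "0 < r" shows "card (wrong_test A c r k m) * (k + 1)\<^sup>2 \<le> 2 ^ m"
proof (cases "(k + 1) ^ 5 \<le> m")
  case True
  let ?S = "\<Sum>\<sigma><(2::nat) ^ m. card (wrong A c r k m (bit \<sigma>))"
  have "card (wrong_test A c r k m) * (r\<^sup>2 * 2 ^ m) = (\<Sum>\<sigma>\<in>wrong_test A c r k m. r\<^sup>2 * 2 ^ m)"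
    by simp
  also have "\<dots> \<le> (\<Sum>\<sigma>\<in>wrong_test A c r k m. card (wrong A c r k m (bit \<sigma>)) * (k + 1)\<^sup>2)"
    by (rule sum_mono) (auto simp: wrong_test_def)
  also have "\<dots> \<le> (\<Sum>\<sigma><(2::nat) ^ m. card (wrong A c r k m (bit \<sigma>)) * (k + 1)\<^sup>2)"
    by (rule sum_mono2) (auto simp: wrong_test_def)
  also have "\<dots> = ?S * (k + 1)\<^sup>2" by (rule sum_distrib_right[symmetric])
  finally have lower: "card (wrong_test A c r k m) * (r\<^sup>2 * 2 ^ m) \<le> ?S * (k + 1)\<^sup>2" .
  have "?S * (4 * (k + 1) ^ 4) = (\<Sum>\<beta><2 ^ m.
      card {\<sigma>::nat. \<sigma> < 2 ^ m \<and> far r k (\<lambda>x. ev A \<beta> m c [x] = Suc (of_bool (\<not> bit \<sigma> x)))} * (4 * (k + 1) ^ 4))"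
    unfolding wrong_def by (subst sum_card_swap) (rule sum_distrib_right)
  also have "\<dots> \<le> (\<Sum>\<beta><(2::nat) ^ m. r\<^sup>2 * 2 ^ m)"
  proof (rule sum_mono)
    fix \<beta> :: nat
    \<comment> \<open>The result 2 codes the answer 1, so every wrong answer about \<sigma> is a
      disagreement between \<open>?w\<close> and \<sigma>.\<close>
    let ?w = "\<lambda>x. ev A \<beta> m c [x] = 2"
    have "card {\<sigma>::nat. \<sigma> < 2 ^ m \<and> far r k (\<lambda>x. ev A \<beta> m c [x] = Suc (of_bool (\<not> bit \<sigma> x)))}
      \<le> card {\<sigma>::nat. \<sigma> < 2 ^ m \<and> far r k (\<lambda>x. ?w x \<noteq> bit \<sigma> x)}"
      by (rule card_mono) (auto elim!: far_mono)
    then have "card {\<sigma>::nat. \<sigma> < 2 ^ m \<and> far r k (\<lambda>x. ev A \<beta> m c [x] = Suc (of_bool (\<not> bit \<sigma> x)))} * (4 * (k + 1) ^ 4)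
      \<le> card {\<sigma>::nat. \<sigma> < 2 ^ m \<and> far r k (\<lambda>x. ?w x \<noteq> bit \<sigma> x)} * (4 * (k + 1) ^ 4)"
      by (rule mult_right_mono) simp
    also have "\<dots> \<le> r\<^sup>2 * 2 ^ m" by (rule card_far_block_le[OF True])
    finally show "card {\<sigma>::nat. \<sigma> < 2 ^ m \<and> far r k (\<lambda>x. ev A \<beta> m c [x] = Suc (of_bool (\<not> bit \<sigma> x)))} * (4 * (k + 1) ^ 4)
      \<le> r\<^sup>2 * 2 ^ m" .
  qed
  finally have upper: "?S * (4 * (k + 1) ^ 4) \<le> 2 ^ m * (r\<^sup>2 * 2 ^ m)" by simp
  \<comment> \<open>The fourth power in the Chebyshev bound pays for two squares: one lost to
    Markov's inequality, one demanded by \<open>small_test\<close>.\<close>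
  have "card (wrong_test A c r k m) * (k + 1)\<^sup>2 * (r\<^sup>2 * 2 ^ m)
      = card (wrong_test A c r k m) * (r\<^sup>2 * 2 ^ m) * (k + 1)\<^sup>2" by (simp only: mult_ac)
  also have "\<dots> \<le> ?S * (k + 1)\<^sup>2 * (k + 1)\<^sup>2" by (rule mult_right_mono[OF lower]) simp
  also have "\<dots> \<le> ?S * (4 * (k + 1) ^ 4)"
    by (simp add: mult.assoc flip: power_add)
  also note upper
  finally show ?thesis using r by simp
qed (auto simp: wrong_test_def)

lemma small_wrong_test: "0 < r \<Longrightarrow> small_test (wrong_test A c r) 1"
proof
  show "wrong_test A c r k m \<subseteq> {..<2 ^ m}" for k m by (auto simp: wrong_test_def)
  assume r: "0 < r"
  show "real (card (wrong_test A c r k m)) * (real k + 1)\<^sup>2 \<le> 1 * 2 ^ m" for k m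
  proof -
    have "real (card (wrong_test A c r k m) * (k + 1)\<^sup>2) \<le> real (2 ^ m)"
      using card_wrong_test[OF r] by (subst of_nat_le_iff)
    then show ?thesis by (simp add: add.commute)
  qed
  fix \<sigma> n m k :: nat
  assume \<sigma>: "\<sigma> < 2 ^ n" "m \<le> n" "take_bit m \<sigma> \<in> wrong_test A c r k m"
  then have km: "(k + 1) ^ 5 \<le> m" by (simp add: wrong_test_def)
  let ?W = "wrong A c r k m (bit \<sigma>)"
  have W: "wrong A c r k m (bit (take_bit m \<sigma>)) = ?W"
    using km by (intro wrong_cong) (auto simp: bit_take_bit_iff block_def)
  \<comment> \<open>All extensions of a wrong \<beta> are wrong, so the proportion of wrong nodes
    does not drop from level \<open>m\<close> to level \<open>n\<close>.\<close>
  have "2 ^ (n - m) * card ?W = card {\<beta>. \<beta> < 2 ^ n \<and> take_bit m \<beta> \<in> ?W}"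
    by (rule card_extensions[symmetric]) (use \<sigma> in \<open>auto simp: wrong_def\<close>)
  also have "\<dots> \<le> card (wrong A c r k n (bit \<sigma>))"
    by (rule card_mono) (auto intro: wrong_mono[OF _ \<sigma>(2)], simp add: wrong_def)
  finally have ext: "2 ^ (n - m) * card ?W \<le> card (wrong A c r k n (bit \<sigma>))" .
  have "(2::nat) ^ n = 2 ^ (n - m) * 2 ^ m" using \<sigma>(2) by (simp flip: power_add)
  then have "r\<^sup>2 * 2 ^ n = 2 ^ (n - m) * (r\<^sup>2 * 2 ^ m)" by (simp only: mult_ac)
  also have "\<dots> < 2 ^ (n - m) * (card ?W * (k + 1)\<^sup>2)"
  proof -
    have "r\<^sup>2 * 2 ^ m < card (wrong A c r k m (bit (take_bit m \<sigma>))) * (k + 1)\<^sup>2"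
      using \<sigma>(3) by (simp add: wrong_test_def)
    then show ?thesis unfolding W by simp
  qed
  also have "\<dots> \<le> card (wrong A c r k n (bit \<sigma>)) * (k + 1)\<^sup>2"
    using mult_right_mono[OF ext, of "(k + 1)\<^sup>2"] by (simp only: mult_ac)
  finally show "\<sigma> \<in> wrong_test A c r k n" using \<sigma> km by (simp add: wrong_test_def)
qed

lemma evading_subtree:
  assumes T: "good_tree A T" and r: "0 < r"
  shows "\<exists>T'. good_tree A T' \<and> (\<forall>n. T' n \<subseteq> T n) \<and> (\<forall>Z. branch T' Z \<longrightarrow> evades A c r Z)"
proof -
  interpret small_test "wrong_test A c r" 1 by (rule small_wrong_test[OF r])
  have "decp A 3 (\<lambda>xs. xs ! 2 \<in> wrong_test A c r (xs ! 0) (xs ! 1))"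
    unfolding wrong_test_def wrong_def mem_Collect_eq
    by (intro rec_intros) simp_all
  from good_tree_thin[OF T small_test_axioms this]
  obtain N where N: "good_tree A (thin T (wrong_test A c r) N)" .
  have "evades A c r Z" if Z: "branch (thin T (wrong_test A c r) N) Z" for Z
    unfolding evades_def
  proof (intro exI[of _ N] allI impI)
    fix k m assume k: "N \<le> k" "(k + 1) ^ 5 \<le> m"
    obtain \<sigma> where \<sigma>: "\<sigma> < 2 ^ m" "approximates \<sigma> m Z" using approximates_exists by blast
    have "btree T" using T by (simp add: good_tree_def)
    from branch_thin[OF this Z k(1)] \<sigma> have "\<sigma> \<notin> wrong_test A c r k m" by blast
    moreover have "wrong A c r k m (bit \<sigma>) = wrong A c r k m (\<lambda>x. x \<in> Z)"
      using \<sigma>(2) k(2) by (intro wrong_cong) (auto simp: approximates_def block_def)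
    ultimately show "card (wrong A c r k m (\<lambda>x. x \<in> Z)) * (k + 1)\<^sup>2 \<le> r\<^sup>2 * 2 ^ m"
      using \<sigma>(1) k(2) by (simp add: wrong_test_def)
  qed
  then show ?thesis using N by (intro exI[of _ "thin T (wrong_test A c r) N"]) (auto simp: thin_def)
qed

section \<open>Approximating computed sets by sets below the base\<close>

text \<open>
  Values above \<open>1\<close> are not counted: a code that computes a set never takes them, and counting them
  would spoil the averaging argument below.
\<close>

definition dissents :: "nat set \<Rightarrow> ocode \<Rightarrow> nat \<Rightarrow> nat \<Rightarrow> (nat \<Rightarrow> bool) \<Rightarrow> nat \<Rightarrow> bool" where
  "dissents A c n \<sigma> P x \<longleftrightarrow> ev A \<sigma> n c [x] = 0 \<or> ev A \<sigma> n c [x] = Suc (of_bool (\<not> P x))"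

text \<open>Double counting: a convergent \<sigma> is far from few strings \<open>y\<close>, so not
  every \<open>y\<close> can be far from many \<sigma>.\<close>

lemma exists_popular_string:
  assumes M: "(k + 1) ^ 5 \<le> M"
    and conv: "\<And>\<sigma> x. \<sigma> \<in> S \<Longrightarrow> x < (k + 1) ^ 5 \<Longrightarrow> ev A \<sigma> n c [x] \<noteq> 0"
  shows "\<exists>y<(2::nat) ^ M. card {\<sigma>. \<sigma> < 2 ^ n \<and> \<sigma> \<in> S \<and> far r k (dissents A c n \<sigma> (bit y))} * (k + 1)\<^sup>2
    \<le> r\<^sup>2 * 2 ^ n"
proof (rule ccontr)
  let ?Q = "\<lambda>y \<sigma>. \<sigma> \<in> S \<and> far r k (dissents A c n \<sigma> (bit (y::nat)))"
  assume "\<not> ?thesis"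
  then have "(\<Sum>y<(2::nat) ^ M. r\<^sup>2 * 2 ^ n) < (\<Sum>y<(2::nat) ^ M. card {\<sigma>. \<sigma> < 2 ^ n \<and> ?Q y \<sigma>} * (k + 1)\<^sup>2)"
    by (intro sum_strict_mono) (auto simp: not_le lessThan_empty_iff)
  also have "\<dots> \<le> (\<Sum>y<(2::nat) ^ M. card {\<sigma>. \<sigma> < 2 ^ n \<and> ?Q y \<sigma>} * (4 * (k + 1) ^ 4))"
  proof (intro sum_mono mult_left_mono)
    have "(k + 1)\<^sup>2 \<le> (k + 1) ^ 4" by (rule power_increasing) auto
    then show "(k + 1)\<^sup>2 \<le> 4 * (k + 1) ^ 4" by linarith
  qed simp
  also have "\<dots> = (\<Sum>\<sigma><2 ^ n. card {y. y < (2::nat) ^ M \<and> ?Q y \<sigma>} * (4 * (k + 1) ^ 4))"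
    unfolding sum_distrib_right[symmetric] by (subst sum_card_swap) (rule refl)
  also have "\<dots> \<le> (\<Sum>\<sigma><(2::nat) ^ n. r\<^sup>2 * 2 ^ M)"
  proof (rule sum_mono)
    fix \<sigma>
    let ?w = "\<lambda>x. ev A \<sigma> n c [x] = 2"
    have "card {y. y < (2::nat) ^ M \<and> ?Q y \<sigma>} \<le> card {y::nat. y < 2 ^ M \<and> far r k (\<lambda>x. ?w x \<noteq> bit y x)}"
    proof (rule card_mono)
      \<comment> \<open>Convergence excludes the result 0, so dissent is a definite wrong answer
        here.\<close>
      have "?w x \<noteq> P x" if "\<sigma> \<in> S" "x \<in> block k" "dissents A c n \<sigma> P x" for x P
        using conv[OF that(1), of x] that(2,3) by (auto simp: dissents_def block_def)
      then show "{y. y < (2::nat) ^ M \<and> ?Q y \<sigma>} \<subseteq> {y::nat. y < 2 ^ M \<and> far r k (\<lambda>x. ?w x \<noteq> bit y x)}"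
        by (auto elim!: far_mono)
    qed simp
    then have "card {y. y < (2::nat) ^ M \<and> ?Q y \<sigma>} * (4 * (k + 1) ^ 4)
      \<le> card {y::nat. y < 2 ^ M \<and> far r k (\<lambda>x. ?w x \<noteq> bit y x)} * (4 * (k + 1) ^ 4)"
      by (rule mult_right_mono) simp
    also have "\<dots> \<le> r\<^sup>2 * 2 ^ M" by (rule card_far_block_le[OF M])
    finally show "card {y. y < (2::nat) ^ M \<and> ?Q y \<sigma>} * (4 * (k + 1) ^ 4) \<le> r\<^sup>2 * 2 ^ M" .
  qed
  finally show False by (simp add: mult_ac)
qed

definition dissenting :: "nat set \<Rightarrow> ocode \<Rightarrow> nat \<Rightarrow> (nat \<Rightarrow> nat set) \<Rightarrow> nat \<Rightarrow> nat \<Rightarrow> nat \<Rightarrow> nat set" where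
  "dissenting A c r T k n y = {\<sigma>. \<sigma> < 2 ^ n \<and> \<sigma> \<in> T n \<and> far r k (dissents A c n \<sigma> (bit y))}"

text \<open>
  If no computation can be forced to diverge on a tree of positive density, then divergence becomes
  rare at high levels, so the approximating string \<open>y\<close> can be found by a search below \<open>A\<close>.
\<close>

lemma exists_dissenting_small:
  assumes T: "btree T"
    and conv: "\<And>x. \<not> fat (\<lambda>n. {\<sigma> \<in> T n. ev A \<sigma> n c [x] = 0})"
    and D_tree: "\<And>x. btree (\<lambda>n. {\<sigma> \<in> T n. ev A \<sigma> n c [x] = 0})"
  shows "\<exists>n. \<exists>y<(2::nat) ^ ((k + 1) ^ 5). card (dissenting A c r T k n y) * (k + 1)\<^sup>2 \<le> (1 + r\<^sup>2) * 2 ^ n"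
proof -
  let ?D = "\<lambda>x n. {\<sigma> \<in> T n. ev A \<sigma> n c [x] = 0}"
  let ?M = "(k + 1) ^ 5"
  \<comment> \<open>Chosen so that divergence on any of the \<open>(k + 1) ^ 5\<close> inputs
    together affects at most \<open>2 ^ n / (k + 1)^2\<close> nodes.\<close>
  define e :: real where "e = 1 / (?M * (k + 1)\<^sup>2)"
  have e: "e > 0" by (simp add: e_def)
  have "\<forall>\<^sub>F n in sequentially. real (card (?D x n)) \<le> e * 2 ^ n" for x
  proof -
    obtain m where m: "real (card (?D x m)) < e * 2 ^ m"
      using conv[of x] e unfolding fat_def by (auto simp: not_le)
    have "real (card (?D x n)) \<le> e * 2 ^ n" if "m \<le> n" for n
    proof -
      have "real (card (?D x n)) \<le> real (2 ^ (n - m) * card (?D x m))"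
        using card_btree_le[OF D_tree that] by (subst of_nat_le_iff)
      also have "\<dots> \<le> 2 ^ (n - m) * (e * 2 ^ m)" using m by simp
      also have "\<dots> = e * 2 ^ n" using that by (simp flip: power_add)
      finally show ?thesis .
    qed
    then show ?thesis by (rule eventually_sequentiallyI)
  qed
  then have "\<forall>\<^sub>F n in sequentially. \<forall>x\<in>{..<?M}. real (card (?D x n)) \<le> e * 2 ^ n"
    by (intro eventually_ball_finite) auto
  then obtain n where "\<forall>x\<in>{..<?M}. real (card (?D x n)) \<le> e * 2 ^ n"
    unfolding eventually_sequentially by blast
  then have n: "real (card (?D x n)) \<le> e * 2 ^ n" if "x < ?M" for x using that by blast
  \<comment> \<open>The nodes with some divergence are set aside as part of the exceptional set; on
    the others a popular string exists.\<close>
  define U where "U = (\<Union>x<?M. ?D x n)"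
  have "real (card U) \<le> (\<Sum>x<?M. real (card (?D x n)))"
    unfolding U_def by (subst of_nat_sum[symmetric], subst of_nat_le_iff, rule card_UN_le) simp
  also have "\<dots> \<le> (\<Sum>x<?M. e * 2 ^ n)" by (rule sum_mono) (use n in auto)
  also have "\<dots> = ?M * (e * 2 ^ n)" by simp
  finally have "real (card U) * (k + 1)\<^sup>2 \<le> ?M * (e * 2 ^ n) * (k + 1)\<^sup>2"
    by (rule mult_right_mono) simp
  also have "\<dots> = 2 ^ n * ((?M * (k + 1)\<^sup>2) * e)" by (simp only: mult_ac of_nat_mult)
  also have "\<dots> = 2 ^ n" by (simp add: e_def)
  finally have "real (card U * (k + 1)\<^sup>2) \<le> real (2 ^ n)" by simp
  then have U: "card U * (k + 1)\<^sup>2 \<le> 2 ^ n" by (subst (asm) of_nat_le_iff)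
  let ?F = "\<lambda>y. {\<sigma>. \<sigma> < 2 ^ n \<and> \<sigma> \<in> T n - U \<and> far r k (dissents A c n \<sigma> (bit y))}"
  have "ev A \<sigma> n c [x] \<noteq> 0" if "\<sigma> \<in> T n - U" "x < ?M" for \<sigma> x
    using that by (auto simp: U_def)
  from exists_popular_string[OF order_refl this] obtain y :: nat
    where y: "y < 2 ^ ?M" "card (?F y) * (k + 1)\<^sup>2 \<le> r\<^sup>2 * 2 ^ n" by blast
  have finU: "finite U" unfolding U_def by (intro finite_UN_I) (auto intro: btree_finite[OF D_tree])
  have "card (dissenting A c r T k n y) \<le> card (U \<union> ?F y)"
    using finU by (intro card_mono) (auto simp: dissenting_def)
  also have "\<dots> \<le> card U + card (?F y)" by (rule card_Un_le)
  finally have "card (dissenting A c r T k n y) * (k + 1)\<^sup>2 \<le> (card U + card (?F y)) * (k + 1)\<^sup>2"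
    by (rule mult_right_mono) simp
  also have "\<dots> \<le> 2 ^ n + r\<^sup>2 * 2 ^ n" unfolding add_mult_distrib by (rule add_mono[OF U y(2)])
  finally have "card (dissenting A c r T k n y) * (k + 1)\<^sup>2 \<le> (1 + r\<^sup>2) * 2 ^ n"
    by (simp only: add_mult_distrib mult_1)
  with y(1) show ?thesis by blast
qed

text \<open>Vacuously true if \<open>c\<close> computes no set from \<open>join A Z\<close>; forcing
  one divergence meets the requirement in this way.\<close>

definition half_traced :: "nat set \<Rightarrow> ocode \<Rightarrow> nat \<Rightarrow> nat set \<Rightarrow> bool" where
  "half_traced A c r Z \<longleftrightarrow> (\<forall>X. (\<forall>x. computes (join A Z) c [x] (of_bool (x \<in> X))) \<longrightarrow>
     (\<exists>Y. Y \<le>\<^sub>T A \<and> upper_density (sym_diff X Y) \<le> 1 / 2 + 1 / real r))"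

text \<open>Either the nodes diverging at some input form a fat tree, or popular strings
  \<open>yy k\<close> exist for all \<open>k\<close>. In the latter case \<open>A\<close> finds
  them, they are glued to a set \<open>Y\<close>, and the nodes dissenting from them form a small
  test to prune.\<close>

lemma half_traced_subtree:
  assumes T: "good_tree A T" and r: "0 < r"
  shows "\<exists>T'. good_tree A T' \<and> (\<forall>n. T' n \<subseteq> T n) \<and> (\<forall>Z. branch T' Z \<longrightarrow> half_traced A c r Z)"
proof -
  let ?D = "\<lambda>x n. {\<sigma> \<in> T n. ev A \<sigma> n c [x] = 0}"
  have tree: "btree T" and dec: "decp A 2 (\<lambda>xs. xs ! 1 \<in> T (xs ! 0))"
    using T by (auto simp: good_tree_def)
  have D_tree: "btree (?D x)" for x
    unfolding btree_def
  proof (intro conjI allI ballI impI)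
    show "?D x n \<subseteq> {..<2 ^ n}" for n using btree_less[OF tree] by auto
    fix m n \<sigma> assume \<sigma>: "\<sigma> \<in> ?D x n" "m \<le> n"
    have "ev A (take_bit m \<sigma>) m c [x] = 0"
    proof (rule ccontr)
      assume "ev A (take_bit m \<sigma>) m c [x] \<noteq> 0"
      then obtain v where "ev A (take_bit m \<sigma>) m c [x] = Suc v"
        by (cases "ev A (take_bit m \<sigma>) m c [x]") auto
      from ev_mono[OF \<sigma>(2) _ this, of \<sigma>] \<sigma>(1) show False by (simp add: bit_take_bit_iff)
    qed
    with btree_take_bit[OF tree _ \<sigma>(2)] \<sigma>(1) show "take_bit m \<sigma> \<in> ?D x m" by simp
  qed
  show ?thesis
  proof (cases "\<exists>x. fat (?D x)")
    case True
    then obtain x where x: "fat (?D x)" by blast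
    have "decp A 2 (\<lambda>xs. xs ! 1 \<in> ?D x (xs ! 0))"
      unfolding mem_Collect_eq by (intro rec_intros dec) simp_all
    with x D_tree have "good_tree A (?D x)" by (simp add: good_tree_def)
    moreover have "half_traced A c r Z" if Z: "branch (?D x) Z" for Z
    proof -
      have False if X: "computes (join A Z) c [x] v" for v
      proof -
        from ev_complete[OF X] obtain n where
          "\<forall>\<sigma> n'. n \<le> n' \<longrightarrow> approximates \<sigma> n' Z \<longrightarrow> ev A \<sigma> n' c [x] = Suc v" ..
        then have n: "approximates \<sigma> n Z \<Longrightarrow> ev A \<sigma> n c [x] = Suc v" for \<sigma> by simp
        obtain \<sigma> where "\<sigma> \<in> ?D x n" "approximates \<sigma> n Z" using Z unfolding branch_def by blast
        with n[of \<sigma>] show False by simp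
      qed
      then show ?thesis unfolding half_traced_def by blast
    qed
    ultimately show ?thesis by (intro exI[of _ "?D x"]) auto
  next
    case False
    define Q where "Q k n y \<longleftrightarrow> card (dissenting A c r T k n y) * (k + 1)\<^sup>2 \<le> (1 + r\<^sup>2) * 2 ^ n" for k n y
    \<comment> \<open>Two successive searches, both decidable from \<open>A\<close>: first a level
      at which some string works, then the least such string.\<close>
    define nn where "nn k = (LEAST n. \<exists>y<2 ^ ((k + 1) ^ 5). Q k n y)" for k
    define yy where "yy k = (LEAST y. Q k (nn k) y)" for k
    have ex: "\<exists>n. \<exists>y<2 ^ ((k + 1) ^ 5). Q k n y" for k
      unfolding Q_def by (rule exists_dissenting_small[OF tree _ D_tree]) (use False in blast)
    have exQ: "\<exists>y. Q k (nn k) y" for k using LeastI_ex[OF ex[of k]] unfolding nn_def by blast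
    from exQ have Q: "Q k (nn k) (yy k)" for k unfolding yy_def by (rule LeastI_ex)
    have Qdec: "decp A 3 (\<lambda>xs. Q (xs ! 0) (xs ! 1) (xs ! 2))"
      unfolding Q_def dissenting_def dissents_def
      by (intro rec_intros decp_compose2[OF dec]) simp_all
    have "decp A (Suc 1) (\<lambda>ys. \<exists>y<2 ^ ((tl ys ! 0 + 1) ^ 5). Q (tl ys ! 0) (ys ! 0) y)"
      by (intro decp_bex decp_compose3[OF Qdec] rec_intros) simp_all
    from recf_Least[of A 1 "\<lambda>n xs. \<exists>y<2 ^ ((xs ! 0 + 1) ^ 5). Q (xs ! 0) n y", OF this ex]
    have nn: "recf A 1 (\<lambda>xs. nn (xs ! 0))" unfolding nn_def .
    have "decp A (Suc 1) (\<lambda>ys. Q (tl ys ! 0) (nn (tl ys ! 0)) (ys ! 0))"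
      by (intro decp_compose3[OF Qdec] recf_compose1[OF nn] rec_intros) simp_all
    from recf_Least[of A 1 "\<lambda>y xs. Q (xs ! 0) (nn (xs ! 0)) y", OF this exQ]
    have yy: "recf A 1 (\<lambda>xs. yy (xs ! 0))" unfolding yy_def .
    \<comment> \<open>The dissenting nodes are found at the single level \<open>nn k\<close>;
      \<open>V\<close> lifts them to all higher levels.\<close>
    define V where "V k m = {\<sigma>. \<sigma> < 2 ^ m \<and> nn k \<le> m \<and> take_bit (nn k) \<sigma> \<in> dissenting A c r T k (nn k) (yy k)}" for k m
    interpret small_test V "1 + r\<^sup>2"
    proof
      show "V k m \<subseteq> {..<2 ^ m}" for k m by (auto simp: V_def)
      show "\<sigma> \<in> V k n" if "\<sigma> < 2 ^ n" "m \<le> n" "take_bit m \<sigma> \<in> V k m" for \<sigma> n m k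
        using that by (auto simp: V_def min_def)
      show "real (card (V k m)) * (real k + 1)\<^sup>2 \<le> real (1 + r\<^sup>2) * 2 ^ m" for k m
      proof (cases "nn k \<le> m")
        case True
        have "card (V k m) = 2 ^ (m - nn k) * card (dissenting A c r T k (nn k) (yy k))"
          using card_extensions[of "dissenting A c r T k (nn k) (yy k)" "nn k" m] True
          by (auto simp: V_def dissenting_def)
        then have "card (V k m) * (k + 1)\<^sup>2
            = 2 ^ (m - nn k) * (card (dissenting A c r T k (nn k) (yy k)) * (k + 1)\<^sup>2)"
          by (simp only: mult.assoc)
        also have "\<dots> \<le> 2 ^ (m - nn k) * ((1 + r\<^sup>2) * 2 ^ nn k)"
          using Q[of k] unfolding Q_def by (rule mult_left_mono) simp
        also have "\<dots> = (1 + r\<^sup>2) * (2 ^ (m - nn k) * 2 ^ nn k)" by (simp only: mult_ac)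
        also have "(2::nat) ^ (m - nn k) * 2 ^ nn k = 2 ^ m"
          using True by (simp flip: power_add)
        finally have "real (card (V k m) * (k + 1)\<^sup>2) \<le> real ((1 + r\<^sup>2) * 2 ^ m)"
          by (subst of_nat_le_iff)
        then show ?thesis by (simp add: add.commute distrib_right)
      qed (simp add: V_def)
    qed
    have Vdec: "decp A 3 (\<lambda>xs. xs ! 2 \<in> V (xs ! 0) (xs ! 1))"
      unfolding V_def dissenting_def dissents_def mem_Collect_eq
      by (intro rec_intros decp_compose2[OF dec] recf_compose1[OF nn] recf_compose1[OF yy]) simp_all
    obtain N where N: "good_tree A (thin T V N)"
      using good_tree_thin[OF T small_test_axioms Vdec] .
    define Y where "Y = {x. bit (yy (block_index x)) x}"
    have "recf A 1 (\<lambda>xs. block_index (xs ! 0))"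
      unfolding block_index_def
      by (intro recf_Least block_index_exists rec_intros) simp_all
    then have YA: "Y \<le>\<^sub>T A"
      unfolding turing_reducible_iff_decp Y_def mem_Collect_eq
      by (intro rec_intros recf_compose1[OF yy]) simp_all
    have "half_traced A c r Z" if Z: "branch (thin T V N) Z" for Z
      unfolding half_traced_def
    proof (intro allI impI exI[of _ Y] conjI YA upper_density_le_of_blocks[OF r, of N])
      fix X k assume X: "\<forall>x. computes (join A Z) c [x] (of_bool (x \<in> X))" and k: "N \<le> k"
      have "branch T Z" by (rule branch_mono[OF Z]) (auto simp: thin_def)
      then obtain \<sigma> where \<sigma>: "\<sigma> \<in> T (nn k)" "approximates \<sigma> (nn k) Z" unfolding branch_def by blast
      have "\<sigma> \<notin> V k (nn k)" using branch_thin[OF tree Z k] \<sigma>(2) by blast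
      then have "\<not> far r k (dissents A c (nn k) \<sigma> (bit (yy k)))"
        using \<sigma>(1) btree_less[OF tree \<sigma>(1)] by (simp add: V_def dissenting_def take_bit_nat_eq_self)
      \<comment> \<open>Where \<sigma> converges and does not dissent, its answer is the true value
        of \<open>X\<close> by soundness and agrees with \<open>yy k\<close>, that is, with
        \<open>Y\<close> on this block.\<close>
      moreover have *: "dissents A c (nn k) \<sigma> (bit (yy k)) x"
        if x: "x \<in> block k" "x \<in> sym_diff X Y" for x
      proof (rule ccontr)
        assume no: "\<not> ?thesis"
        then obtain v where v: "ev A \<sigma> (nn k) c [x] = Suc v"
          by (cases "ev A \<sigma> (nn k) c [x]") (auto simp: dissents_def)
        from ev_sound[OF _ v, of Z] \<sigma>(2) have "computes (join A Z) c [x] v"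
          by (simp add: approximates_def)
        from computes_functional[OF this] X have "of_bool (x \<in> X) = v" by blast
        moreover have "x \<in> X \<longleftrightarrow> \<not> bit (yy k) x"
          using x block_index_eq[OF x(1)] by (auto simp: Y_def)
        ultimately show False using no v by (simp add: dissents_def)
      qed
      ultimately show "\<not> far r k (\<lambda>x. x \<in> sym_diff X Y)"
        by (metis (no_types, lifting) far_mono)
    qed
    with N show ?thesis by (intro exI[of _ "thin T V N"]) (auto simp: thin_def)
  qed
qed

section \<open>The generic sets\<close>

instance ocode :: countable by countable_datatype

lemma exists_traced_evading:
  "\<exists>Z. \<forall>c. \<forall>r>0. half_traced A c r Z \<and> evades A c r Z"
proof -
  \<comment> \<open>The boolean selects the kind of requirement, so that one countable index type
    enumerates both kinds.\<close>
  define R where "R i Z \<longleftrightarrow> (case i of (c, r, b) \<Rightarrow>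
      0 < r \<longrightarrow> (if b then half_traced A c r Z else evades A c r Z))" for i :: "ocode \<times> nat \<times> bool" and Z
  have "\<exists>Z. \<forall>i. R i Z"
  proof (rule generic_branch[of "good_tree A"])
    have "decp A 2 (\<lambda>xs. xs ! 1 \<in> {..<2 ^ (xs ! 0)})"
      unfolding lessThan_iff by (intro rec_intros) simp_all
    then show "good_tree A (\<lambda>n. {..<2 ^ n})" using full_tree by (simp add: good_tree_def)
    show "btree T \<and> fat T" if "good_tree A T" for T using that by (simp add: good_tree_def)
    fix T and i :: "ocode \<times> nat \<times> bool" assume T: "good_tree A T"
    obtain c r b where i: "i = (c, r, b)" by (cases i)
    show "\<exists>T'. good_tree A T' \<and> (\<forall>n. T' n \<subseteq> T n) \<and> (\<forall>Z. branch T' Z \<longrightarrow> R i Z)"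
    proof (cases "0 < r")
      case True
      then show ?thesis
        using half_traced_subtree[OF T True, of c] evading_subtree[OF T True, of c]
        by (cases b) (auto simp: R_def i)
    next
      case False
      then show ?thesis using T by (intro exI[of _ T]) (simp add: R_def i)
    qed
  qed
  then obtain Z where Z: "\<And>i. R i Z" by blast
  show ?thesis
  proof (intro exI[of _ Z] allI impI conjI)
    fix c and r :: nat assume "0 < r"
    then show "half_traced A c r Z" "evades A c r Z"
      using Z[of "(c, r, True)"] Z[of "(c, r, False)"] by (simp_all add: R_def)
  qed
qed

section \<open>Sets avoiding countably many tests\<close>

definition avoids :: "(nat \<Rightarrow> nat \<Rightarrow> nat set) \<Rightarrow> nat set \<Rightarrow> bool" where
  "avoids V Z \<longleftrightarrow> (\<exists>N. \<forall>k\<ge>N. \<forall>m. \<forall>\<sigma>\<in>V k m. \<not> approximates \<sigma> m Z)"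

text \<open>The conditions are arbitrary fat trees, so the tests may have any complexity; those used
  below are built from the generic sets themselves.\<close>

lemma exists_avoiding:
  fixes V :: "'i::countable \<Rightarrow> nat \<Rightarrow> nat \<Rightarrow> nat set"
  assumes "\<And>i. small_test (V i) (K i)"
  shows "\<exists>Z. \<forall>i. avoids (V i) Z"
proof (rule generic_branch[of "\<lambda>T. btree T \<and> fat T"])
  show "btree (\<lambda>n. {..<2 ^ n}) \<and> fat (\<lambda>n. {..<2 ^ n})" using full_tree by blast
  fix T i assume T: "btree T \<and> fat T"
  interpret small_test "V i" "K i" by (rule assms)
  obtain N where "fat (thin T (V i) N)" using fat_thin T by blast
  moreover have "avoids (V i) Z" if "branch (thin T (V i) N) Z" for Z
    unfolding avoids_def using branch_thin[OF _ that] T by blast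
  ultimately show "\<exists>T'. (btree T' \<and> fat T') \<and> (\<forall>n. T' n \<subseteq> T n) \<and> (\<forall>Z. branch T' Z \<longrightarrow> avoids (V i) Z)"
    using btree_thin T by (intro exI[of _ "thin T (V i) N"]) (auto simp: thin_def)
qed blast

definition far_test :: "nat set \<Rightarrow> nat \<Rightarrow> nat \<Rightarrow> nat \<Rightarrow> nat set" where
  "far_test X r k m = {\<beta>. \<beta> < 2 ^ m \<and> (k + 1) ^ 5 \<le> m \<and> far r k (\<lambda>x. (x \<in> X) \<noteq> bit \<beta> x)}"

lemma small_far_test: "small_test (far_test X r) (r\<^sup>2)"
proof
  show "far_test X r k m \<subseteq> {..<2 ^ m}" for k m by (auto simp: far_test_def)
  show "\<sigma> \<in> far_test X r k n" if "\<sigma> < 2 ^ n" "m \<le> n" "take_bit m \<sigma> \<in> far_test X r k m" for \<sigma> n m k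
    using that by (auto simp: far_test_def bit_take_bit_iff block_def elim!: far_mono)
  show "real (card (far_test X r k m)) * (real k + 1)\<^sup>2 \<le> real (r\<^sup>2) * 2 ^ m" for k m
  proof (cases "(k + 1) ^ 5 \<le> m")
    case True
    have "(k + 1)\<^sup>2 \<le> (k + 1) ^ 4" by (rule power_increasing) auto
    then have "(k + 1)\<^sup>2 \<le> 4 * (k + 1) ^ 4" by linarith
    then have "card (far_test X r k m) * (k + 1)\<^sup>2 \<le> card (far_test X r k m) * (4 * (k + 1) ^ 4)"
      by (rule mult_left_mono) simp
    also have "\<dots> \<le> r\<^sup>2 * 2 ^ m"
      using card_far_block_le[OF True, of r "\<lambda>x. x \<in> X"] True by (simp add: far_test_def)
    finally have "real (card (far_test X r k m) * (k + 1)\<^sup>2) \<le> real (r\<^sup>2 * 2 ^ m)"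
      by (subst of_nat_le_iff)
    then show ?thesis by (simp add: add.commute)
  qed (auto simp: far_test_def)
qed

lemma avoids_far_test:
  assumes "avoids (far_test X r) B" "0 < r"
  shows "upper_density (sym_diff X B) \<le> 1 / 2 + 1 / real r"
proof -
  obtain N where N: "\<And>k m \<sigma>. N \<le> k \<Longrightarrow> \<sigma> \<in> far_test X r k m \<Longrightarrow> \<not> approximates \<sigma> m B"
    using assms(1) unfolding avoids_def by blast
  show ?thesis
  proof (rule upper_density_le_of_blocks[OF assms(2), of N])
    fix k assume k: "N \<le> k"
    let ?m = "(k + 1) ^ 5"
    obtain \<sigma> where \<sigma>: "\<sigma> < 2 ^ ?m" "approximates \<sigma> ?m B" using approximates_exists by blast
    with N[OF k, of \<sigma> ?m] have "\<not> far r k (\<lambda>x. (x \<in> X) \<noteq> bit \<sigma> x)" by (auto simp: far_test_def)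
    then show "\<not> far r k (\<lambda>x. x \<in> sym_diff X B)"
      by (rule contrapos_nn) (erule far_mono, use \<sigma>(2) in \<open>auto simp: approximates_def block_def\<close>)
  qed
qed

text \<open>The test is empty wherever \<open>evades\<close> provides no bound, which makes the
  estimate of \<open>small_test\<close> hold for all \<open>k\<close> and \<open>m\<close>.\<close>

definition evasion_test :: "nat set \<Rightarrow> ocode \<Rightarrow> nat \<Rightarrow> nat set \<Rightarrow> nat \<Rightarrow> nat \<Rightarrow> nat \<Rightarrow> nat set" where
  "evasion_test A c r Z N k m =
    (if N \<le> k \<and> (k + 1) ^ 5 \<le> m then wrong A c r k m (\<lambda>x. x \<in> Z) else {})"

lemma evades_small_test:
  assumes "evades A c r Z" obtains N where "small_test (evasion_test A c r Z N) (r\<^sup>2)"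
proof -
  obtain N where N: "\<And>k m. N \<le> k \<Longrightarrow> (k + 1) ^ 5 \<le> m
      \<Longrightarrow> card (wrong A c r k m (\<lambda>x. x \<in> Z)) * (k + 1)\<^sup>2 \<le> r\<^sup>2 * 2 ^ m"
    using assms unfolding evades_def by blast
  have "small_test (evasion_test A c r Z N) (r\<^sup>2)"
  proof
    show "evasion_test A c r Z N k m \<subseteq> {..<2 ^ m}" for k m
      by (auto simp: evasion_test_def wrong_def)
    show "\<sigma> \<in> evasion_test A c r Z N k n"
      if "\<sigma> < 2 ^ n" "m \<le> n" "take_bit m \<sigma> \<in> evasion_test A c r Z N k m" for \<sigma> n m k
      using that by (auto simp: evasion_test_def intro: wrong_mono split: if_splits)
    show "real (card (evasion_test A c r Z N k m)) * (real k + 1)\<^sup>2 \<le> real (r\<^sup>2) * 2 ^ m" for k m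
    proof (cases "N \<le> k \<and> (k + 1) ^ 5 \<le> m")
      case True
      then have "real (card (evasion_test A c r Z N k m) * (k + 1)\<^sup>2) \<le> real (r\<^sup>2 * 2 ^ m)"
        unfolding evasion_test_def using N by (subst of_nat_le_iff) simp
      then show ?thesis by (simp add: add.commute)
    qed (auto simp: evasion_test_def)
  qed
  then show ?thesis by (rule that)
qed

lemma avoids_evasion_test:
  assumes avoids: "avoids (evasion_test A c r Z N) B" and r: "0 < r"
    and X: "\<And>x. computes (join A B) c [x] (of_bool (x \<in> X))"
  shows "upper_density (sym_diff X Z) \<le> 1 / 2 + 1 / real r"
proof -
  obtain N' where N': "\<And>k m \<sigma>. N' \<le> k \<Longrightarrow> \<sigma> \<in> evasion_test A c r Z N k m \<Longrightarrow> \<not> approximates \<sigma> m B"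
    using avoids unfolding avoids_def by blast
  show ?thesis
  proof (rule upper_density_le_of_blocks[OF r, of "max N N'"])
    fix k assume k: "max N N' \<le> k"
    have "\<forall>x. \<exists>n. \<forall>\<sigma> n'. n \<le> n' \<longrightarrow> approximates \<sigma> n' B \<longrightarrow> ev A \<sigma> n' c [x] = Suc (of_bool (x \<in> X))"
      using ev_complete[OF X] by blast
    then obtain f where f: "\<And>x \<sigma> n'. f x \<le> n' \<Longrightarrow> approximates \<sigma> n' B
        \<Longrightarrow> ev A \<sigma> n' c [x] = Suc (of_bool (x \<in> X))"
      by metis
    \<comment> \<open>By this level all computations on block \<open>k\<close> have converged along
      \<open>B\<close>, so each point where \<open>X\<close> differs from \<open>Z\<close> shows up
      as a definite wrong answer.\<close>
    define m where "m = (k + 1) ^ 5 + (\<Sum>x\<in>block k. f x)"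
    have fm: "f x \<le> m" if "x \<in> block k" for x
      unfolding m_def using member_le_sum[OF that, of f] by (simp add: block_def)
    obtain \<sigma> where \<sigma>: "\<sigma> < 2 ^ m" "approximates \<sigma> m B" using approximates_exists by blast
    have "\<sigma> \<notin> evasion_test A c r Z N k m" using N'[of k \<sigma> m] k \<sigma>(2) by auto
    then have "\<not> far r k (\<lambda>x. ev A \<sigma> m c [x] = Suc (of_bool (x \<notin> Z)))"
      using k \<sigma>(1) by (auto simp: evasion_test_def wrong_def m_def)
    then show "\<not> far r k (\<lambda>x. x \<in> sym_diff X Z)"
      by (rule contrapos_nn) (erule far_mono, use f[OF fm \<sigma>(2)] in auto)
  qed
qed

text \<open>The boolean index lets a single \<open>B\<close> serve both endpoints. Both kinds of
  bounds, for all codes and all \<open>r\<close>, are countably many small tests for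
  \<open>B\<close> to avoid.\<close>

lemma exists_common_neighbour:
  fixes A Z :: "bool \<Rightarrow> nat set"
  assumes ev: "\<And>i c r. 0 < r \<Longrightarrow> evades (A i) c r (Z i)"
  shows "\<exists>B. \<forall>i. (\<forall>X. X \<le>\<^sub>T join (A i) B \<longrightarrow> upper_density (sym_diff X (Z i)) \<le> 1 / 2)
    \<and> (\<forall>X. X \<le>\<^sub>T join (A i) (Z i) \<longrightarrow> upper_density (sym_diff X B) \<le> 1 / 2)"
proof -
  have "\<exists>N. small_test (evasion_test (A i) c (Suc r) (Z i) N) ((Suc r)\<^sup>2)" for i c r
    using evades_small_test[OF ev[of "Suc r" i c]] by auto
  then obtain N where N: "\<And>i c r. small_test (evasion_test (A i) c (Suc r) (Z i) (N i c r)) ((Suc r)\<^sup>2)"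
    by metis
  \<comment> \<open>Indexing by codes makes the sets below \<open>join (A i) (Z i)\<close>
    countable; codes that compute no set merely add further sets.\<close>
  define S where "S i c = {x. computes (join (A i) (Z i)) c [x] 1}" for i c
  define V where "V = (\<lambda>(i, c, r, b). if b then evasion_test (A i) c (Suc r) (Z i) (N i c r)
    else far_test (S i c) (Suc r))"
  have "small_test (V j) (real ((Suc (fst (snd (snd j))))\<^sup>2))" for j
    using N small_far_test by (cases j) (auto simp: V_def simp del: of_nat_Suc of_nat_power)
  from exists_avoiding[of V "\<lambda>j. real ((Suc (fst (snd (snd j))))\<^sup>2)", OF this] obtain B where B: "\<And>j. avoids (V j) B" by blast
  have limit: "u \<le> 1 / 2" if "\<And>r. u \<le> 1 / 2 + 1 / real (Suc r)" for u :: real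
  proof (rule field_le_epsilon)
    fix e :: real assume "0 < e"
    then obtain r where "inverse (real (Suc r)) < e" using reals_Archimedean by blast
    with that[of r] show "u \<le> 1 / 2 + e" by (simp add: inverse_eq_divide)
  qed
  show ?thesis
  proof (intro exI[of _ B] allI conjI impI limit)
    fix i X r
    assume "X \<le>\<^sub>T join (A i) B"
    then obtain c where "\<And>x. computes (join (A i) B) c [x] (of_bool (x \<in> X))"
      by (auto simp: turing_reducible_def)
    from avoids_evasion_test[OF _ _ this, of "Suc r" "Z i" "N i c r"] B[of "(i, c, r, True)"]
    show "upper_density (sym_diff X (Z i)) \<le> 1 / 2 + 1 / real (Suc r)" by (simp add: V_def)
  next
    fix i X r
    assume "X \<le>\<^sub>T join (A i) (Z i)"
    then obtain c where c: "\<And>x. computes (join (A i) (Z i)) c [x] (of_bool (x \<in> X))"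
      by (auto simp: turing_reducible_def)
    have "x \<in> S i c \<longleftrightarrow> x \<in> X" for x
      using c[of x] computes_functional[OF c[of x], of 1] by (cases "x \<in> X") (auto simp: S_def)
    then have "S i c = X" by blast
    with avoids_far_test[of "S i c" "Suc r" B] B[of "(i, c, r, False)"]
    show "upper_density (sym_diff X B) \<le> 1 / 2 + 1 / real (Suc r)" by (simp add: V_def)
  qed
qed

section \<open>Distances between degrees\<close>

lemma turing_reducible_Compl: "Y \<le>\<^sub>T A \<Longrightarrow> - Y \<le>\<^sub>T A"
  unfolding turing_reducible_iff_decp Compl_iff by (rule decp_not)

lemma upper_density_UNIV: "upper_density UNIV = 1"
proof -
  have "\<forall>\<^sub>F n in sequentially. ereal (partial_density n UNIV) = 1"
    by (rule eventually_sequentiallyI[of 1]) (simp add: partial_density_def)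
  then have "limsup (\<lambda>n. ereal (partial_density n UNIV)) = limsup (\<lambda>n. 1)" by (rule Limsup_eq)
  then have "ereal (upper_density UNIV) = 1" by (simp add: ereal_upper_density Limsup_const)
  then show ?thesis by simp
qed

text \<open>A set and its complement are at distance 1, so being close to one means being far from
  the other. Since lower cones are closed under complement, upper bounds of 1/2 thus give lower
  bounds.\<close>

lemma half_le_upper_density_Compl:
  assumes "upper_density (sym_diff (- Y) Z) \<le> 1 / 2"
  shows "1 / 2 \<le> upper_density (sym_diff Z Y)"
proof -
  have "sym_diff (- Y) Y = UNIV" by auto
  then have "1 \<le> upper_density (sym_diff (- Y) Z) + upper_density (sym_diff Z Y)"
    using upper_density_triangle[of "- Y" Y Z] by (simp add: upper_density_UNIV)
  with assms show ?thesis by linarith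
qed

lemma infdist_closure_le:
  fixes S T :: "'a::metric_space set"
  assumes "\<And>x. x \<in> S \<Longrightarrow> infdist x T \<le> c" "x \<in> closure S"
  shows "infdist x (closure T) \<le> c"
proof -
  have "closed {x. infdist x T \<le> c}"
    by (intro closed_Collect_le continuous_on_infdist continuous_on_id continuous_on_const)
  then have "closure S \<subseteq> {x. infdist x T \<le> c}" using assms(1) by (intro closure_minimal) auto
  then show ?thesis using assms(2) by (auto simp: infdist_eq_setdist)
qed

text \<open>A Hausdorff distance is a maximum of two suprema, so one witness on one side gives the
  lower bound. Passing to closures is harmless because \<open>infdist\<close> is continuous and
  unchanged by closing the target.\<close>

lemma hausdorff_dist_closure_eq:
  fixes S T :: "'a::metric_space set"
  assumes S: "\<And>x. x \<in> S \<Longrightarrow> infdist x T \<le> c" and T: "\<And>y. y \<in> T \<Longrightarrow> infdist y S \<le> c"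
    and x: "x \<in> S" "c \<le> infdist x T" and "T \<noteq> {}"
  shows "hausdorff_dist (closure S) (closure T) = c"
proof -
  have Sc: "infdist x (closure T) \<le> c" if "x \<in> closure S" for x
    using infdist_closure_le[OF S that] .
  have Tc: "infdist y (closure S) \<le> c" if "y \<in> closure T" for y
    using infdist_closure_le[OF T that] .
  have "(SUP x\<in>closure S. infdist x (closure T)) \<le> c"
    using x(1) Sc by (intro cSUP_least) auto
  moreover have "(SUP y\<in>closure T. infdist y (closure S)) \<le> c"
    using assms(5) Tc by (intro cSUP_least) auto
  moreover have "c \<le> (SUP x\<in>closure S. infdist x (closure T))"
  proof (rule cSUP_upper2)
    show "bdd_above ((\<lambda>x. infdist x (closure T)) ` closure S)"
      using Sc by (intro bdd_aboveI2)
    show "x \<in> closure S" using x(1) closure_subset by blast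
    show "c \<le> infdist x (closure T)" using x(2) by (simp add: infdist_eq_setdist)
  qed
  ultimately show ?thesis unfolding hausdorff_dist_def by linarith
qed

lemma degree_dist_eq_half:
  assumes AB: "\<And>X r. X \<le>\<^sub>T A \<Longrightarrow> 0 < r \<Longrightarrow> \<exists>Y. Y \<le>\<^sub>T B \<and> upper_density (sym_diff X Y) \<le> 1 / 2 + 1 / real r"
    and BA: "\<And>X r. X \<le>\<^sub>T B \<Longrightarrow> 0 < r \<Longrightarrow> \<exists>Y. Y \<le>\<^sub>T A \<and> upper_density (sym_diff X Y) \<le> 1 / 2 + 1 / real r"
    and W: "W \<le>\<^sub>T A" "\<And>Y. Y \<le>\<^sub>T B \<Longrightarrow> 1 / 2 \<le> upper_density (sym_diff W Y)"
  shows "degree_dist (abs_turing_degree A) (abs_turing_degree B) = 1 / 2"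
proof -
  let ?C = "\<lambda>A. {abs_coarse_class X | X. X \<le>\<^sub>T A}"
  have C: "classes_below (abs_turing_degree A) = ?C A" for A
    by (simp add: classes_below_def reducible_to_degree.abs_eq)
  have le: "infdist x (?C B) \<le> 1 / 2"
    if AB: "\<And>X r. X \<le>\<^sub>T A \<Longrightarrow> 0 < r \<Longrightarrow> \<exists>Y. Y \<le>\<^sub>T B \<and> upper_density (sym_diff X Y) \<le> 1 / 2 + 1 / real r"
      and x: "x \<in> ?C A" for A B x
  proof (rule field_le_epsilon)
    fix e :: real assume "0 < e"
    then obtain r where r: "inverse (real (Suc r)) < e" using reals_Archimedean by blast
    obtain X where X: "x = abs_coarse_class X" "X \<le>\<^sub>T A" using x by blast
    obtain Y where Y: "Y \<le>\<^sub>T B" "upper_density (sym_diff X Y) \<le> 1 / 2 + 1 / real (Suc r)"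
      using AB[OF X(2), of "Suc r"] by auto
    have "infdist x (?C B) \<le> dist x (abs_coarse_class Y)"
      using Y(1) by (intro infdist_le) blast
    also have "\<dots> = upper_density (sym_diff X Y)" by (simp add: X(1) dist_coarse_class.abs_eq)
    finally show "infdist x (?C B) \<le> 1 / 2 + e" using Y(2) r by (simp add: inverse_eq_divide)
  qed
  have ne: "?C B \<noteq> {}" using turing_reducible_refl by blast
  have "1 / 2 \<le> infdist (abs_coarse_class W) (?C B)"
    unfolding infdist_notempty[OF ne]
    using ne W(2) by (intro cINF_greatest) (auto simp: dist_coarse_class.abs_eq)
  then show ?thesis unfolding degree_dist_def C
    using W(1) ne le[OF AB] le[OF BA] by (intro hausdorff_dist_closure_eq) blast+
qed

section \<open>The path of length four\<close>

lemma half_path: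
  fixes A :: "bool \<Rightarrow> nat set"
  shows "\<exists>C B. \<forall>i. degree_dist (abs_turing_degree (A i)) (abs_turing_degree (C i)) = 1 / 2
    \<and> degree_dist (abs_turing_degree (C i)) (abs_turing_degree B) = 1 / 2"
proof -
  have "\<forall>i. \<exists>Z. \<forall>c. \<forall>r>0. half_traced (A i) c r Z \<and> evades (A i) c r Z"
    using exists_traced_evading by blast
  then obtain Z where Z: "\<And>i c r. 0 < r \<Longrightarrow> half_traced (A i) c r (Z i)"
    "\<And>i c r. 0 < r \<Longrightarrow> evades (A i) c r (Z i)" by metis
  obtain B where B1: "\<And>i X. X \<le>\<^sub>T join (A i) B \<Longrightarrow> upper_density (sym_diff X (Z i)) \<le> 1 / 2"
    and B2: "\<And>i X. X \<le>\<^sub>T join (A i) (Z i) \<Longrightarrow> upper_density (sym_diff X B) \<le> 1 / 2"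
    using exists_common_neighbour[of A Z, OF Z(2)] by blast
  define C where "C i = join (A i) (Z i)" for i
  have below: "A i \<le>\<^sub>T C i" "Z i \<le>\<^sub>T C i" for i by (simp_all add: C_def le_join)
  have add: "u \<le> 1 / 2 + 1 / real r" if "u \<le> 1 / 2" for u r using that by (simp add: add_increasing2)
  have "degree_dist (abs_turing_degree (C i)) (abs_turing_degree (A i)) = 1 / 2" for i
  proof (rule degree_dist_eq_half)
    fix X and r :: nat assume "X \<le>\<^sub>T C i" "0 < r"
    then obtain c where "\<forall>x. computes (join (A i) (Z i)) c [x] (of_bool (x \<in> X))"
      by (auto simp: turing_reducible_def C_def)
    with Z(1)[OF \<open>0 < r\<close>, of i c]
    show "\<exists>Y. Y \<le>\<^sub>T A i \<and> upper_density (sym_diff X Y) \<le> 1 / 2 + 1 / real r"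
      unfolding half_traced_def by simp
  next
    fix X and r :: nat assume "X \<le>\<^sub>T A i"
    then have "X \<le>\<^sub>T C i" using below(1) turing_reducible_trans by blast
    then show "\<exists>Y. Y \<le>\<^sub>T C i \<and> upper_density (sym_diff X Y) \<le> 1 / 2 + 1 / real r"
      by (intro exI[of _ X]) (simp add: upper_density_empty)
  next
    \<comment> \<open>The witness is \<open>Z i\<close>; its bound for sets below
      \<open>join (A i) B\<close> applies because this join lies above \<open>A i\<close>.\<close>
    fix Y assume "Y \<le>\<^sub>T A i"
    then have "- Y \<le>\<^sub>T join (A i) B"
      using turing_reducible_Compl le_join(1) turing_reducible_trans by blast
    from B1[OF this] show "1 / 2 \<le> upper_density (sym_diff (Z i) Y)"
      by (rule half_le_upper_density_Compl)
  qed (rule below)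
  then have CA: "degree_dist (abs_turing_degree (A i)) (abs_turing_degree (C i)) = 1 / 2" for i
    by (simp add: degree_dist_commute)
  have "degree_dist (abs_turing_degree B) (abs_turing_degree (C i)) = 1 / 2" for i
  proof (rule degree_dist_eq_half)
    fix X and r :: nat assume "X \<le>\<^sub>T B"
    then have "X \<le>\<^sub>T join (A i) B" using le_join(2) turing_reducible_trans by blast
    \<comment> \<open>The single set \<open>Z i\<close> is within 1/2 of every set below
      \<open>B\<close>.\<close>
    from add[OF B1[OF this]] below(2)
    show "\<exists>Y. Y \<le>\<^sub>T C i \<and> upper_density (sym_diff X Y) \<le> 1 / 2 + 1 / real r" by blast
  next
    fix X and r :: nat assume "X \<le>\<^sub>T C i"
    \<comment> \<open>Conversely, the single set \<open>B\<close> is within 1/2 of every set below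
      \<open>C i\<close>.\<close>
    from add[OF B2[OF this[unfolded C_def]]] turing_reducible_refl
    show "\<exists>Y. Y \<le>\<^sub>T B \<and> upper_density (sym_diff X Y) \<le> 1 / 2 + 1 / real r" by blast
  next
    fix Y assume "Y \<le>\<^sub>T C i"
    then have "- Y \<le>\<^sub>T join (A i) (Z i)" unfolding C_def by (rule turing_reducible_Compl)
    from B2[OF this] show "1 / 2 \<le> upper_density (sym_diff B Y)"
      by (rule half_le_upper_density_Compl)
  qed (rule turing_reducible_refl)
  then have "degree_dist (abs_turing_degree (C i)) (abs_turing_degree B) = 1 / 2" for i
    by (simp add: degree_dist_commute)
  with CA show ?thesis by blast
qed

lemma half_graph_walk:
  "\<exists>p. pre_digraph.awalk (with_proj half_graph) u p v \<and> length p = 4"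
proof -
  interpret wf_digraph "with_proj half_graph" by (rule half_graph_simple)
  have arc: "(a, b) \<in> parcs half_graph \<longleftrightarrow> degree_dist a b = 1 / 2" for a b
    by (simp add: half_graph_def)
  have verts: "pverts half_graph = UNIV" by (simp add: half_graph_def)
  have ex: "\<exists>a. w = abs_turing_degree a" for w
    by (induct w rule: turing_degree.abs_induct) blast
  obtain a b where ab: "u = abs_turing_degree a" "v = abs_turing_degree b"
    using ex[of u] ex[of v] by blast
  obtain C B where CB: "\<And>i. degree_dist (abs_turing_degree (if i then a else b)) (abs_turing_degree (C i)) = 1 / 2
      \<and> degree_dist (abs_turing_degree (C i)) (abs_turing_degree B) = 1 / 2"
    using half_path[of "\<lambda>i. if i then a else b"] by presburger
  let ?C = "\<lambda>i. abs_turing_degree (C i)" and ?B = "abs_turing_degree B"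
  \<comment> \<open>A walk may repeat vertices, so the case \<open>u = v\<close> is covered as
    well.\<close>
  have "awalk u [(u, ?C True), (?C True, ?B), (?B, ?C False), (?C False, v)] v"
    using CB[of True] CB[of False]
    by (simp add: awalk_simps arc verts ab degree_dist_commute)
  then show ?thesis by (intro exI conjI) (assumption, simp)
qed

theorem theorem6p6:
  shows "Digraph_Component.connected (with_proj half_graph) \<and>
    graph_diameter (with_proj half_graph) \<le> 4"
proof
  interpret wf_digraph "with_proj half_graph" by (rule half_graph_simple)
  have walk: "\<exists>p. awalk u p v \<and> length p = 4" for u v by (rule half_graph_walk)
  show "Digraph_Component.connected (with_proj half_graph)"
    unfolding connected_def
  proof
    show "verts (with_proj (mk_symmetric (with_proj half_graph))) \<noteq> {}" by (simp add: half_graph_def)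
    fix u v
    \<comment> \<open>Connectedness refers to the symmetric closure, in which reachability
      persists.\<close>
    have "u \<rightarrow>\<^sup>*\<^bsub>with_proj half_graph\<^esub> v"
      unfolding reachable_awalk using walk[of u v] by blast
    then show "u \<rightarrow>\<^sup>*\<^bsub>with_proj (mk_symmetric (with_proj half_graph))\<^esub> v"
      by (rule reachable_mk_symmetricI)
  qed
  have "\<mu> (\<lambda>_. 1) u v \<le> 4" for u v
  proof -
    obtain p where p: "awalk u p v" "length p = 4" using walk by blast
    have "awalk_cost (\<lambda>_. 1) p = 4" using p(2) by (simp add: awalk_cost_def sum_list_triv)
    with min_cost_le_walk_cost[OF p(1), of "\<lambda>_. 1"] show ?thesis by simp
  qed
  then show "graph_diameter (with_proj half_graph) \<le> 4"
    unfolding graph_diameter_def by (intro SUP_least)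
qed

end
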